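(* Let $A$ be a finite-dimensional Hopf algebra over the field $\Bbbk$ with a nonzero left integral $\Lambda$ and a normalized twist $J$. For any $n\in\mathbb{Z}$, we have: (1) $P_n^J(\Lambda)=T\,P_n(\Lambda)$, where $T=J^{-(1)}\alpha(J^{-(2)})$; (2) $P_n^J(\Lambda)=Q_J^{-1}\,P_n(\Lambda)\,S(R)\,Q_J$, where $R=\alpha(J^{-(1)})J^{-(2)}$. If, moreover, $A$ is unimodular, then $P_n^J(\Lambda)=P_n(\Lambda)$ for any $n\in\mathbb{Z}$.
   Context: $\Bbbk$ is an arbitrary field; $A$ has comultiplication $\Delta(a)=a_{(1)}\otimes a_{(2)}$ (Sweedler notation), counit $\varepsilon$, antipode $S$. A left integral $\Lambda\in A$ satisfies $a\Lambda=\varepsilon(a)\Lambda$ for all $a\in A$. The distinguished group-like element $\alpha\in A^*$ is the algebra map defined by $\Lambda a=\alpha(a)\Lambda$ for $a\in A$; $A$ is unimodular if $\alpha=\varepsilon$. A normalized twist for $A$ is an invertible $J\in A\otimes A$ with $(\varepsilon\otimes id)(J)=(id\otimes\varepsilon)(J)=1$ and $(\Delta\otimes id)(J)(J\otimes 1)=(id\otimes\Delta)(J)(1\otimes J)$. Write $J=J^{(1)}\otimes J^{(2)}$ and $J^{-1}=J^{-(1)}\otimes J^{-(2)}$ (summation understood). Put $Q_J=S(J^{(1)})J^{(2)}$, which is invertible with inverse $Q_J^{-1}=J^{-(1)}S(J^{-(2)})$. The twisted Hopf algebra $A^J$ has the same algebra structure and counit as $A$, comultiplication $\Delta^J(a)=J^{-1}\Delta(a)J$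 and antipode $S^J(a)=Q_J^{-1}S(a)Q_J$. The $n$-th Sweedler power map $P_n:A\to A$ is $P_n(a)=a_{(1)}\cdots a_{(n)}$ for $n\ge1$, $P_0(a)=\varepsilon(a)1$, and $P_n(a)=S(a_{(-n)}\cdots a_{(1)})$ for $n\le-1$ (in the last case the factors are the $|n|$ tensor legs of the iterated comultiplication of $a$, multiplied in decreasing order of index). $P_n^J$ denotes the $n$-th Sweedler power map of $A^J$, i.e. the same map formed with $\Delta^J$ and $S^J$. *)

theory Defs
  imports Complex_Main "HOL-Library.Poly_Mapping"
begin

section \<open>Tensor powers of a vector space\<close>

text \<open>
  The library has no tensor products of vector spaces.  The \<open>n\<close>-fold tensor power of the vector space
  with carrier type \<open>'a\<close> and scalar multiplication \<open>scl\<close> is built here in the standard way: the free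
  vector space on the words \<open>[a\<^sub>1, \<dots>, a\<^sub>n]\<close> modulo the subspace generated by the multilinearity
  relations.  A tensor is a coset, i.e. a set of formal linear combinations of words, so equality of
  tensors is equality.  The coset of the word \<open>[a\<^sub>1, \<dots>, a\<^sub>n]\<close> is the pure tensor
  \<open>a\<^sub>1 \<otimes> \<dots> \<otimes> a\<^sub>n\<close>; all tensor powers live in the same type, and associativity of the tensor
  product is built into the concatenation of words.
\<close>

type_synonym ('a, 'k) formal = "'a list \<Rightarrow>\<^sub>0 'k"
type_synonym ('a, 'k) tensor = "('a, 'k) formal set"

definition formal_scale :: "'k::field \<Rightarrow> ('a, 'k) formal \<Rightarrow> ('a, 'k) formal" where
  "formal_scale c = Poly_Mapping.map ((*) c)"

definition word :: "'a list \<Rightarrow> ('a, 'k::field) formal" where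
  "word w = Poly_Mapping.single w 1"

definition words_space :: "nat \<Rightarrow> ('a, 'k::field) formal set" where
  "words_space n = {p. \<forall>w \<in> Poly_Mapping.keys p. length w = n}"

text \<open>The linear extension of a function on words to the free vector space, with values in the vector
  space whose scalar multiplication is \<open>sc\<close>.\<close>

definition lin_ext ::
    "('k::field \<Rightarrow> 'b \<Rightarrow> 'b::comm_monoid_add) \<Rightarrow> ('a list \<Rightarrow> 'b) \<Rightarrow> ('a, 'k) formal \<Rightarrow> 'b" where
  "lin_ext sc f p = (\<Sum>w \<in> Poly_Mapping.keys p. sc (Poly_Mapping.lookup p w) (f w))"

definition multilinear_rels ::
    "('k::field \<Rightarrow> 'a \<Rightarrow> 'a::ab_group_add) \<Rightarrow> nat \<Rightarrow> ('a, 'k) formal set" where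
  "multilinear_rels scl n =
     {word (u @ (a + b) # v) - word (u @ a # v) - word (u @ b # v) | u a b v.
        length u + 1 + length v = n} \<union>
     {word (u @ scl c a # v) - formal_scale c (word (u @ a # v)) | u c a v.
        length u + 1 + length v = n}"

definition tensor_class ::
    "('k::field \<Rightarrow> 'a \<Rightarrow> 'a::ab_group_add) \<Rightarrow> nat \<Rightarrow> ('a, 'k) formal \<Rightarrow> ('a, 'k) tensor" where
  "tensor_class scl n p =
     {q \<in> words_space n. q - p \<in> module.span formal_scale (multilinear_rels scl n)}"

definition tensor_power ::
    "('k::field \<Rightarrow> 'a \<Rightarrow> 'a::ab_group_add) \<Rightarrow> nat \<Rightarrow> ('a, 'k) tensor set" where
  "tensor_power scl n = tensor_class scl n ` words_space n"

definition pure_tensor ::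
    "('k::field \<Rightarrow> 'a \<Rightarrow> 'a::ab_group_add) \<Rightarrow> 'a list \<Rightarrow> ('a, 'k) tensor" where
  "pure_tensor scl w = tensor_class scl (length w) (word w)"

text \<open>The operations below are defined through an arbitrary representative of a coset.\<close>

definition tensor_rep :: "('a, 'k::field) tensor \<Rightarrow> ('a, 'k) formal" where
  "tensor_rep t = (SOME p. p \<in> t)"

definition tensor_add where
  "tensor_add scl n s t = tensor_class scl n (tensor_rep s + tensor_rep t)"

definition tensor_scale where
  "tensor_scale scl n c t = tensor_class scl n (formal_scale c (tensor_rep t))"

text \<open>The image of \<open>t\<close> under the linear map into \<open>'a\<close> induced by a function \<open>f\<close> that is multilinear
  on words of the relevant length, e.g. \<open>prod_list\<close> for the iterated multiplication.\<close>

definition tensor_eval ::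
    "('k::field \<Rightarrow> 'a \<Rightarrow> 'a::ab_group_add) \<Rightarrow> ('a list \<Rightarrow> 'a) \<Rightarrow> ('a, 'k) tensor \<Rightarrow> 'a" where
  "tensor_eval scl f t = lin_ext scl f (tensor_rep t)"

text \<open>Sweedler-style sums: for \<open>t = t\<^sup>1 \<otimes> t\<^sup>2\<close> (summation understood) and a bilinear \<open>f\<close>, this is
  \<open>f t\<^sup>1 t\<^sup>2\<close>.\<close>

definition sweedler_sum ::
    "('k::field \<Rightarrow> 'a \<Rightarrow> 'a::ab_group_add) \<Rightarrow> ('a \<Rightarrow> 'a \<Rightarrow> 'a) \<Rightarrow> ('a, 'k) tensor \<Rightarrow> 'a" where
  "sweedler_sum scl f t = tensor_eval scl (\<lambda>w. f (w ! 0) (w ! 1)) t"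

text \<open>The outer product of an \<open>m\<close>-tensor and an \<open>n\<close>-tensor.\<close>

definition tensor_prod ::
    "('k::field \<Rightarrow> 'a \<Rightarrow> 'a::ab_group_add) \<Rightarrow> nat \<Rightarrow> nat \<Rightarrow>
      ('a, 'k) tensor \<Rightarrow> ('a, 'k) tensor \<Rightarrow> ('a, 'k) tensor" where
  "tensor_prod scl m n s t = tensor_class scl (m + n)
     (lin_ext formal_scale (\<lambda>u. lin_ext formal_scale (\<lambda>v. word (u @ v)) (tensor_rep t)) (tensor_rep s))"

text \<open>The factorwise multiplication of the algebra \<open>A \<otimes> \<dots> \<otimes> A\<close> (\<open>n\<close> factors).\<close>

definition tensor_mult ::
    "('k::field \<Rightarrow> 'a \<Rightarrow> 'a::ring_1) \<Rightarrow> nat \<Rightarrow>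
      ('a, 'k) tensor \<Rightarrow> ('a, 'k) tensor \<Rightarrow> ('a, 'k) tensor" where
  "tensor_mult scl n s t = tensor_class scl n
     (lin_ext formal_scale
        (\<lambda>u. lin_ext formal_scale (\<lambda>v. word (map2 (*) u v)) (tensor_rep t)) (tensor_rep s))"

definition tensor_one :: "('k::field \<Rightarrow> 'a \<Rightarrow> 'a::ring_1) \<Rightarrow> nat \<Rightarrow> ('a, 'k) tensor" where
  "tensor_one scl n = pure_tensor scl (replicate n 1)"

definition is_tensor_inverse ::
    "('k::field \<Rightarrow> 'a \<Rightarrow> 'a::ring_1) \<Rightarrow> nat \<Rightarrow> ('a, 'k) tensor \<Rightarrow> ('a, 'k) tensor \<Rightarrow> bool" where
  "is_tensor_inverse scl n t s \<longleftrightarrow> s \<in> tensor_power scl n \<and>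
     tensor_mult scl n t s = tensor_one scl n \<and> tensor_mult scl n s t = tensor_one scl n"

definition tensor_inverse ::
    "('k::field \<Rightarrow> 'a \<Rightarrow> 'a::ring_1) \<Rightarrow> nat \<Rightarrow> ('a, 'k) tensor \<Rightarrow> ('a, 'k) tensor" where
  "tensor_inverse scl n t = (THE s. is_tensor_inverse scl n t s)"

text \<open>Apply a map \<open>D : A \<rightarrow> A \<otimes> A\<close> to the tensor factor number \<open>i < n\<close> (counted from 0) of an
  \<open>n\<close>-tensor, i.e. the map \<open>id \<otimes> \<dots> \<otimes> D \<otimes> \<dots> \<otimes> id\<close> to \<open>(n + 1)\<close>-tensors.\<close>

definition comult_at ::
    "('k::field \<Rightarrow> 'a \<Rightarrow> 'a::ab_group_add) \<Rightarrow> nat \<Rightarrow> nat \<Rightarrow> ('a \<Rightarrow> ('a, 'k) tensor) \<Rightarrow>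
      ('a, 'k) tensor \<Rightarrow> ('a, 'k) tensor" where
  "comult_at scl n i D t = tensor_class scl (n + 1)
     (lin_ext formal_scale
        (\<lambda>w. lin_ext formal_scale (\<lambda>v. word (take i w @ v @ drop (i + 1) w)) (tensor_rep (D (w ! i))))
        (tensor_rep t))"


section \<open>Hopf algebras\<close>

locale k_algebra = vector_space scl
  for scl :: "'k::field \<Rightarrow> 'a::ring_1 \<Rightarrow> 'a" +
  assumes scl_mult_left: "scl c x * y = scl c (x * y)"
    and scl_mult_right: "x * scl c y = scl c (x * y)"

definition algebra_character ::
    "('k::field \<Rightarrow> 'a \<Rightarrow> 'a::ring_1) \<Rightarrow> ('a \<Rightarrow> 'k) \<Rightarrow> bool" where
  "algebra_character scl f \<longleftrightarrow>
     Vector_Spaces.linear scl (*) f \<and> f 1 = 1 \<and> (\<forall>a b. f (a * b) = f a * f b)"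

locale hopf_algebra = k_algebra scl
  for scl :: "'k::field \<Rightarrow> 'a::ring_1 \<Rightarrow> 'a" +
  fixes \<Delta> :: "'a \<Rightarrow> ('a, 'k) tensor"
    and \<epsilon> :: "'a \<Rightarrow> 'k"
    and S :: "'a \<Rightarrow> 'a"
  assumes comult_closed: "\<Delta> a \<in> tensor_power scl 2"
    and comult_add: "\<Delta> (a + b) = tensor_add scl 2 (\<Delta> a) (\<Delta> b)"
    and comult_scale: "\<Delta> (scl c a) = tensor_scale scl 2 c (\<Delta> a)"
    and comult_one: "\<Delta> 1 = tensor_one scl 2"
    and comult_mult: "\<Delta> (a * b) = tensor_mult scl 2 (\<Delta> a) (\<Delta> b)"
    and counit_character: "algebra_character scl \<epsilon>"
    and coassoc: "comult_at scl 2 0 \<Delta> (\<Delta> a) = comult_at scl 2 1 \<Delta> (\<Delta> a)"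
    and counit_left: "sweedler_sum scl (\<lambda>x y. scl (\<epsilon> x) y) (\<Delta> a) = a"
    and counit_right: "sweedler_sum scl (\<lambda>x y. scl (\<epsilon> y) x) (\<Delta> a) = a"
    and antipode_linear: "Vector_Spaces.linear scl scl S"
    and antipode_left: "sweedler_sum scl (\<lambda>x y. S x * y) (\<Delta> a) = scl (\<epsilon> a) 1"
    and antipode_right: "sweedler_sum scl (\<lambda>x y. x * S y) (\<Delta> a) = scl (\<epsilon> a) 1"

definition left_integral ::
    "('k::field \<Rightarrow> 'a \<Rightarrow> 'a::ring_1) \<Rightarrow> ('a \<Rightarrow> 'k) \<Rightarrow> 'a \<Rightarrow> bool" where
  "left_integral scl \<epsilon> \<Lambda> \<longleftrightarrow> (\<forall>a. a * \<Lambda> = scl (\<epsilon> a) \<Lambda>)"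

text \<open>For a nonzero left integral \<open>\<Lambda>\<close> of a finite-dimensional Hopf algebra, such a character exists
  and is unique.\<close>

definition distinguished_grouplike ::
    "('k::field \<Rightarrow> 'a \<Rightarrow> 'a::ring_1) \<Rightarrow> 'a \<Rightarrow> ('a \<Rightarrow> 'k)" where
  "distinguished_grouplike scl \<Lambda> =
     (THE \<alpha>. algebra_character scl \<alpha> \<and> (\<forall>a. \<Lambda> * a = scl (\<alpha> a) \<Lambda>))"

text \<open>\<open>iterated_comult scl D m a\<close> is the iterated comultiplication with \<open>m + 1\<close> legs,
  \<open>a\<^sub>1 \<otimes> \<dots> \<otimes> a\<^sub>m\<^sub>+\<^sub>1\<close>.\<close>

primrec iterated_comult ::
    "('k::field \<Rightarrow> 'a \<Rightarrow> 'a::ab_group_add) \<Rightarrow> ('a \<Rightarrow> ('a, 'k) tensor) \<Rightarrow> nat \<Rightarrow> 'a \<Rightarrow> ('a, 'k) tensor" where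
  "iterated_comult scl D 0 a = pure_tensor scl [a]"
| "iterated_comult scl D (Suc m) a = comult_at scl (Suc m) 0 D (iterated_comult scl D m a)"

definition sweedler_power ::
    "('k::field \<Rightarrow> 'a \<Rightarrow> 'a::ring_1) \<Rightarrow> ('a \<Rightarrow> ('a, 'k) tensor) \<Rightarrow> ('a \<Rightarrow> 'k) \<Rightarrow> ('a \<Rightarrow> 'a) \<Rightarrow>
      int \<Rightarrow> 'a \<Rightarrow> 'a" where
  "sweedler_power scl \<Delta> \<epsilon> S n a =
     (if n \<ge> 1 then tensor_eval scl prod_list (iterated_comult scl \<Delta> (nat n - 1) a)
      else if n = 0 then scl (\<epsilon> a) 1
      else S (tensor_eval scl (\<lambda>w. prod_list (rev w)) (iterated_comult scl \<Delta> (nat (- n) - 1) a)))"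


section \<open>Twists\<close>

definition normalized_twist ::
    "('k::field \<Rightarrow> 'a \<Rightarrow> 'a::ring_1) \<Rightarrow> ('a \<Rightarrow> ('a, 'k) tensor) \<Rightarrow> ('a \<Rightarrow> 'k) \<Rightarrow>
      ('a, 'k) tensor \<Rightarrow> bool" where
  "normalized_twist scl \<Delta> \<epsilon> J \<longleftrightarrow>
     J \<in> tensor_power scl 2 \<and>
     (\<exists>K. is_tensor_inverse scl 2 J K) \<and>
     sweedler_sum scl (\<lambda>x y. scl (\<epsilon> x) y) J = 1 \<and>
     sweedler_sum scl (\<lambda>x y. scl (\<epsilon> y) x) J = 1 \<and>
     tensor_mult scl 3 (comult_at scl 2 0 \<Delta> J) (tensor_prod scl 2 1 J (tensor_one scl 1)) =
     tensor_mult scl 3 (comult_at scl 2 1 \<Delta> J) (tensor_prod scl 1 2 (tensor_one scl 1) J)"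

definition ring_inverse :: "'a::ring_1 \<Rightarrow> 'a" where
  "ring_inverse x = (THE y. x * y = 1 \<and> y * x = 1)"

definition twist_Q ::
    "('k::field \<Rightarrow> 'a \<Rightarrow> 'a::ring_1) \<Rightarrow> ('a \<Rightarrow> 'a) \<Rightarrow> ('a, 'k) tensor \<Rightarrow> 'a" where
  "twist_Q scl S J = sweedler_sum scl (\<lambda>x y. S x * y) J"

definition twisted_comult ::
    "('k::field \<Rightarrow> 'a \<Rightarrow> 'a::ring_1) \<Rightarrow> ('a \<Rightarrow> ('a, 'k) tensor) \<Rightarrow> ('a, 'k) tensor \<Rightarrow>
      'a \<Rightarrow> ('a, 'k) tensor" where
  "twisted_comult scl \<Delta> J a =
     tensor_mult scl 2 (tensor_mult scl 2 (tensor_inverse scl 2 J) (\<Delta> a)) J"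

definition twisted_antipode ::
    "('k::field \<Rightarrow> 'a \<Rightarrow> 'a::ring_1) \<Rightarrow> ('a \<Rightarrow> 'a) \<Rightarrow> ('a, 'k) tensor \<Rightarrow> 'a \<Rightarrow> 'a" where
  "twisted_antipode scl S J a = ring_inverse (twist_Q scl S J) * S a * twist_Q scl S J"

end

theory Submission
  imports Defs
begin

text \<open>
  Write \<open>K\<close> for the inverse of the twist \<open>J\<close>, \<open>P\<^sub>n\<close> for the Sweedler powers, and
  \<open>\<phi>(a) = a\<^sub>1 \<alpha>(a\<^sub>2)\<close>, an algebra endomorphism of the Hopf algebra.  Two identities hold for all
  elements \<open>a\<close>, \<open>b\<close>, not only for integrals, and for all \<open>n \<ge> 1\<close>:

    \<open>b\<^sub>1 P\<^sub>n(a b\<^sub>2) = P\<^sub>n(b\<^sub>1 a) b\<^sub>2\<close>   (lemma \<open>sweedler_shift\<close>),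

    \<open>K\<^sup>1 P\<^sub>n(a K\<^sup>2) = P\<^sup>J\<^sub>n(K\<^sup>1 a) K\<^sup>2\<close>   (lemma \<open>sweedler_twist\<close>).

  For the first, both sides are \<open>b\<^sub>1 a\<^sub>1 b\<^sub>2 a\<^sub>2 \<dots> a\<^sub>n b\<^sub>n\<^sub>+\<^sub>1\<close>.  The second follows from it by induction
  on \<open>n\<close>: the twist equation rewrites the comultiplication in the second leg of \<open>K\<close>, after which the
  factors of \<open>J\<close> and \<open>K\<close> that belong to one step of the induction form exactly one twisted
  comultiplication.  For \<open>a = \<Lambda>\<close> the left factor of \<open>\<Lambda>\<close> is absorbed by the counit and the right one by
  \<open>\<alpha>\<close>, so the second identity becomes \<open>T P\<^sub>n(\<Lambda>) = P\<^sup>J\<^sub>n(\<Lambda>)\<close>, and the first becomes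
  \<open>\<phi>(b) P\<^sub>n(\<Lambda>) = P\<^sub>n(\<Lambda>) b\<close>.

  The negative powers come from the same two identities in the co-opposite bialgebra, with the twist
  \<open>J\<close> flipped: for the reversed product \<open>N = \<Lambda>\<^sub>n \<dots> \<Lambda>\<^sub>1\<close> they give \<open>N\<^sup>J = R N\<close>, and applying the
  twisted antipode yields the second formula for \<open>P\<^sup>J\<^sub>-\<^sub>n\<close>.  They also give \<open>S(N) a = \<phi>(a) S(N)\<close>, by
  way of \<open>\<phi>(S(b)) = \<alpha>(S(b\<^sub>1)) S(b\<^sub>2)\<close> and the surjectivity of \<open>S\<close>.

  The two formulas are thus equivalent as soon as \<open>Q\<^sup>-\<^sup>1 \<phi>(S(R) Q) = T\<close>, which is a computation with
  the twist equation alone (lemma \<open>act_S_R_Q\<close>).  In the unimodular case \<open>T = 1\<close>, because the twist is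
  normalized.  The power \<open>n = 0\<close> reduces to this case, since \<open>\<epsilon>(\<Lambda>) \<noteq> 0\<close> forces \<open>\<alpha> = \<epsilon>\<close>.

  That the distinguished character exists rests on the uniqueness of integrals up to scalars.  This and
  the surjectivity of \<open>S\<close> both follow from the injectivity of the map \<open>f \<mapsto> \<Lambda>\<^sub>1 f(S(\<Lambda>\<^sub>2))\<close> on the dual
  space, which is the part of the fundamental theorem of Hopf modules that matters here.

  Elements of a tensor square are represented by finite lists of pairs.  Two lists represent the same
  tensor as soon as all bilinear maps agree on them, and only the consequences of an equality of tensors
  for such evaluations enter the argument.  Sweedler notation then becomes a nested finite sum.  The only
  place where tensors themselves must be shown equal is the uniqueness of the inverse of \<open>J\<close>.
\<close>

section \<open>Multilinear evaluation of tensors\<close>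

lemma lookup_formal_scale [simp]:
  "Poly_Mapping.lookup (formal_scale c p) w = c * Poly_Mapping.lookup p w"
  by (simp add: formal_scale_def Poly_Mapping.map.rep_eq when_def)

lemma vector_space_formal: "vector_space (formal_scale :: 'k::field \<Rightarrow> ('a, 'k) formal \<Rightarrow> _)"
  by standard (auto intro!: poly_mapping_eqI simp: lookup_add algebra_simps)

lemma lin_ext_superset:
  assumes "vector_space sc" "finite X" "Poly_Mapping.keys p \<subseteq> X"
  shows "lin_ext sc f p = (\<Sum>w\<in>X. sc (Poly_Mapping.lookup p w) (f w))"
proof -
  interpret vector_space sc by fact
  show ?thesis
    unfolding lin_ext_def using assms(2,3)
    by (intro sum.mono_neutral_left) (auto simp: in_keys_iff)
qed

lemma lin_ext_linear:
  assumes "vector_space sc"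
  shows "Vector_Spaces.linear formal_scale sc (lin_ext sc f)"
proof -
  interpret W: vector_space sc by fact
  interpret V: vector_space "formal_scale :: 'a \<Rightarrow> ('c, 'a) formal \<Rightarrow> _" by (rule vector_space_formal)
  show ?thesis
  proof (intro Vector_Spaces.linear_iff[THEN iffD2] conjI allI)
    fix p q :: "('c, 'a) formal" and c
    let ?X = "Poly_Mapping.keys p \<union> Poly_Mapping.keys q"
    show "lin_ext sc f (p + q) = lin_ext sc f p + lin_ext sc f q"
      using keys_add[of p q]
      by (simp add: lin_ext_superset[OF assms, of ?X] lookup_add W.scale_left_distrib sum.distrib)
    have "Poly_Mapping.keys (formal_scale c p) \<subseteq> Poly_Mapping.keys p"
      by (auto simp: in_keys_iff)
    then show "lin_ext sc f (formal_scale c p) = sc c (lin_ext sc f p)"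
      by (simp add: lin_ext_superset[OF assms, of "Poly_Mapping.keys p"] W.scale_sum_right)
  qed (unfold_locales)
qed

lemma lin_ext_word [simp]:
  assumes "vector_space sc" shows "lin_ext sc f (word w) = f w"
proof -
  interpret vector_space sc by fact
  show ?thesis by (simp add: lin_ext_def word_def)
qed

lemma lin_ext_word_self: "lin_ext formal_scale word p = p"
proof -
  have "lin_ext formal_scale word p = (\<Sum>w\<in>Poly_Mapping.keys p. Poly_Mapping.single w (Poly_Mapping.lookup p w))"
    unfolding lin_ext_def word_def
    by (intro sum.cong refl poly_mapping_eqI) (simp add: lookup_single when_def)
  also have "\<dots> = p"
    by (rule poly_mapping_eqI) (simp add: lookup_sum lookup_single when_def in_keys_iff sum.delta')
  finally show ?thesis .
qed

lemma lin_ext_lin_ext: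
  assumes "vector_space sc"
  shows "lin_ext sc f (lin_ext formal_scale g p) = lin_ext sc (\<lambda>w. lin_ext sc f (g w)) p"
proof -
  interpret L: Vector_Spaces.linear formal_scale sc "lin_ext sc f" by (rule lin_ext_linear[OF assms])
  show ?thesis
    unfolding lin_ext_def[of formal_scale] by (simp add: L.sum L.scale) (simp add: lin_ext_def)
qed

lemma lin_ext_cong_words:
  assumes "p \<in> words_space n" "\<And>w. length w = n \<Longrightarrow> f w = g w"
  shows "lin_ext sc f p = lin_ext sc g p"
  using assms unfolding lin_ext_def words_space_def by (intro sum.cong) auto

lemma words_space_add: "p \<in> words_space n \<Longrightarrow> q \<in> words_space n \<Longrightarrow> p + q \<in> words_space n"
  using keys_add[of p q] by (auto simp: words_space_def)

lemma words_space_scale: "p \<in> words_space n \<Longrightarrow> formal_scale c p \<in> words_space n"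
  by (auto simp: words_space_def in_keys_iff)

lemma words_space_zero: "0 \<in> words_space n"
  by (auto simp: words_space_def)

lemma words_space_word: "length w = n \<Longrightarrow> word w \<in> words_space n"
  by (auto simp: words_space_def word_def split: if_splits)

lemma words_space_lin_ext:
  assumes "p \<in> words_space m" "\<And>w. length w = m \<Longrightarrow> g w \<in> words_space n"
  shows "lin_ext formal_scale g p \<in> words_space n"
proof -
  have "(\<Sum>w\<in>X. formal_scale (Poly_Mapping.lookup p w) (g w)) \<in> words_space n"
    if "X \<subseteq> Poly_Mapping.keys p" "finite X" for X
    using that(2,1)
  proof (induction X rule: finite_induct)
    case (insert x X)
    then have "length x = m" using assms(1) by (auto simp: words_space_def)
    then show ?case
      using insert assms(2) by (auto intro!: words_space_add words_space_scale)
  qed (simp add: words_space_zero)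
  from this[OF order_refl] show ?thesis by (simp add: lin_ext_def)
qed

context vector_space
begin

text \<open>
  Extending a basis of the span by \<open>x\<close> leaves the value at \<open>x\<close> free.
\<close>

lemma functional_separating_span:
  assumes "x \<notin> span U"
  shows "\<exists>\<phi>. Vector_Spaces.linear scale (*) \<phi> \<and> (\<forall>u\<in>U. \<phi> u = 0) \<and> \<phi> x = 1"
proof -
  interpret F: vector_space "(*) :: 'a \<Rightarrow> 'a \<Rightarrow> 'a"
    by standard (auto simp: algebra_simps)
  interpret vector_space_pair scale "(*) :: 'a \<Rightarrow> 'a \<Rightarrow> 'a" ..
  obtain B where B: "B \<subseteq> U" "independent B" "U \<subseteq> span B"
    using maximal_independent_subset by metis
  have "x \<notin> span B" using assms B(1) span_mono by blast
  then have ind: "independent (insert x B)" using B(2) by (simp add: independent_insert)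
  obtain \<phi> where \<phi>: "Vector_Spaces.linear scale (*) \<phi>"
      "\<forall>y\<in>insert x B. \<phi> y = (if y = x then 1 else 0)"
    using linear_independent_extend[OF ind, of "\<lambda>y. if y = x then 1 else 0"] by auto
  have "x \<notin> B" using \<open>x \<notin> span B\<close> span_base by blast
  then have "\<phi> y = 0" if "y \<in> B" for y using \<phi>(2) that by auto
  then have "\<forall>u\<in>span B. \<phi> u = 0"
    using linear_eq_0_on_span[OF \<phi>(1)] by blast
  then show ?thesis using \<phi> B(3) by auto
qed

end

context k_algebra
begin

definition lin :: "('a \<Rightarrow> 'a) \<Rightarrow> bool" where
  "lin f \<longleftrightarrow> (\<forall>x y. f (x + y) = f x + f y) \<and> (\<forall>c x. f (scl c x) = scl c (f x))"

definition multilin :: "nat \<Rightarrow> ('a list \<Rightarrow> 'a) \<Rightarrow> bool" where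
  "multilin n f \<longleftrightarrow> (\<forall>u v. length u + 1 + length v = n \<longrightarrow> lin (\<lambda>x. f (u @ x # v)))"

abbreviation ev :: "('a, 'k) tensor \<Rightarrow> ('a list \<Rightarrow> 'a) \<Rightarrow> 'a" where
  "ev t f \<equiv> tensor_eval scl f t"

lemma lin_ext_scl_linear: "Vector_Spaces.linear formal_scale scl (lin_ext scl f)"
  by (rule lin_ext_linear) unfold_locales

text \<open>
  The relations are exactly the equations that a multilinear function satisfies; this makes evaluation
  at a tensor independent of the chosen representative.
\<close>

lemma lin_ext_vanishes_on_rels:
  assumes "multilin n f" "p \<in> module.span formal_scale (multilinear_rels scl n)"
  shows "lin_ext scl f p = 0"
proof -
  interpret V: vector_space "formal_scale :: 'k \<Rightarrow> ('a, 'k) formal \<Rightarrow> _" by (rule vector_space_formal)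
  interpret L: Vector_Spaces.linear formal_scale scl "lin_ext scl f" by (rule lin_ext_scl_linear)
  have w: "lin_ext scl f (word u) = f u" for u by (simp add: vector_space_axioms)
  show ?thesis
    using assms(2)
  proof (induction rule: V.span_induct_alt)
    case (step c r q)
    have "lin_ext scl f r = 0"
      using step(1) assms(1)
      by (auto simp: multilinear_rels_def L.diff L.scale w multilin_def lin_def)
    then show ?case using step by (simp add: L.add L.scale)
  qed (simp add: L.zero)
qed

lemma tensor_rep_class:
  assumes "p \<in> words_space n"
  shows "tensor_rep (tensor_class scl n p) \<in> tensor_class scl n p"
proof -
  interpret V: vector_space "formal_scale :: 'k \<Rightarrow> ('a, 'k) formal \<Rightarrow> _" by (rule vector_space_formal)
  have "p \<in> tensor_class scl n p" using assms by (simp add: tensor_class_def V.span_zero)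
  then show ?thesis unfolding tensor_rep_def by (rule someI)
qed

lemma tensor_rep_words: "t \<in> tensor_power scl n \<Longrightarrow> tensor_rep t \<in> words_space n"
  using tensor_rep_class unfolding tensor_power_def by (force simp: tensor_class_def)

lemma tensor_class_rep:
  assumes "t \<in> tensor_power scl n" shows "tensor_class scl n (tensor_rep t) = t"
proof -
  interpret V: vector_space "formal_scale :: 'k \<Rightarrow> ('a, 'k) formal \<Rightarrow> _" by (rule vector_space_formal)
  obtain p where p: "p \<in> words_space n" "t = tensor_class scl n p"
    using assms by (auto simp: tensor_power_def)
  let ?U = "V.span (multilinear_rels scl n)"
  have r: "tensor_rep t - p \<in> ?U"
    using tensor_rep_class[OF p(1)] p(2) by (simp add: tensor_class_def)
  have "q - tensor_rep t \<in> ?U \<longleftrightarrow> q - p \<in> ?U" for q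
    using V.span_add[OF _ r, of "q - tensor_rep t"] V.span_diff[OF _ r, of "q - p"] by auto
  then show ?thesis using p(2) by (simp add: tensor_class_def)
qed

lemma ev_class:
  assumes "p \<in> words_space n" "multilin n f"
  shows "ev (tensor_class scl n p) f = lin_ext scl f p"
proof -
  interpret V: vector_space "formal_scale :: 'k \<Rightarrow> ('a, 'k) formal \<Rightarrow> _" by (rule vector_space_formal)
  interpret L: Vector_Spaces.linear formal_scale scl "lin_ext scl f" by (rule lin_ext_scl_linear)
  have "tensor_rep (tensor_class scl n p) - p \<in> V.span (multilinear_rels scl n)"
    using tensor_rep_class[OF assms(1)] by (simp add: tensor_class_def)
  from lin_ext_vanishes_on_rels[OF assms(2) this] show ?thesis
    by (simp add: tensor_eval_def L.diff)
qed

lemma tensor_classI: "p \<in> words_space n \<Longrightarrow> tensor_class scl n p \<in> tensor_power scl n"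
  by (simp add: tensor_power_def)

lemma ev_cong:
  assumes "t \<in> tensor_power scl n" "\<And>w. length w = n \<Longrightarrow> f w = g w"
  shows "ev t f = ev t g"
  unfolding tensor_eval_def by (rule lin_ext_cong_words[OF tensor_rep_words]) (use assms in auto)

lemma ev_pure: "multilin (length w) f \<Longrightarrow> ev (pure_tensor scl w) f = f w"
  by (simp add: pure_tensor_def ev_class words_space_word vector_space_axioms)

lemma pure_tensor_closed: "length w = n \<Longrightarrow> pure_tensor scl w \<in> tensor_power scl n"
  by (auto simp: pure_tensor_def intro!: tensor_classI words_space_word)

lemma ev_add:
  assumes "s \<in> tensor_power scl n" "t \<in> tensor_power scl n" "multilin n f"
  shows "ev (tensor_add scl n s t) f = ev s f + ev t f"
proof -
  interpret L: Vector_Spaces.linear formal_scale scl "lin_ext scl f" by (rule lin_ext_scl_linear)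
  show ?thesis using assms
    by (simp add: tensor_add_def ev_class words_space_add tensor_rep_words L.add)
      (simp add: tensor_eval_def)
qed

lemma ev_scale:
  assumes "t \<in> tensor_power scl n" "multilin n f"
  shows "ev (tensor_scale scl n c t) f = scl c (ev t f)"
proof -
  interpret L: Vector_Spaces.linear formal_scale scl "lin_ext scl f" by (rule lin_ext_scl_linear)
  show ?thesis using assms
    by (simp add: tensor_scale_def ev_class words_space_scale tensor_rep_words L.scale)
      (simp add: tensor_eval_def)
qed

lemma
  assumes s: "s \<in> tensor_power scl n" and t: "t \<in> tensor_power scl n"
  shows tensor_mult_closed: "tensor_mult scl n s t \<in> tensor_power scl n"
    and ev_mult: "multilin n f \<Longrightarrow>
      ev (tensor_mult scl n s t) f = ev s (\<lambda>u. ev t (\<lambda>v. f (map2 (*) u v)))"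
proof -
  have *: "lin_ext formal_scale (\<lambda>u. lin_ext formal_scale (\<lambda>v. word (map2 (*) u v)) (tensor_rep t))
      (tensor_rep s) \<in> words_space n"
    by (intro words_space_lin_ext[OF tensor_rep_words[OF s]]
        words_space_lin_ext[OF tensor_rep_words[OF t]] words_space_word) auto
  then show "tensor_mult scl n s t \<in> tensor_power scl n"
    by (simp add: tensor_mult_def tensor_classI)
  show "ev (tensor_mult scl n s t) f = ev s (\<lambda>u. ev t (\<lambda>v. f (map2 (*) u v)))" if "multilin n f"
    using * that by (simp add: tensor_mult_def ev_class lin_ext_lin_ext vector_space_axioms)
      (simp add: tensor_eval_def)
qed

lemma
  assumes s: "s \<in> tensor_power scl m" and t: "t \<in> tensor_power scl n"
  shows tensor_prod_closed: "tensor_prod scl m n s t \<in> tensor_power scl (m + n)"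
    and ev_prod: "multilin (m + n) f \<Longrightarrow>
      ev (tensor_prod scl m n s t) f = ev s (\<lambda>u. ev t (\<lambda>v. f (u @ v)))"
proof -
  have *: "lin_ext formal_scale (\<lambda>u. lin_ext formal_scale (\<lambda>v. word (u @ v)) (tensor_rep t))
      (tensor_rep s) \<in> words_space (m + n)"
    by (intro words_space_lin_ext[OF tensor_rep_words[OF s]]
        words_space_lin_ext[OF tensor_rep_words[OF t]] words_space_word) auto
  then show "tensor_prod scl m n s t \<in> tensor_power scl (m + n)"
    by (simp add: tensor_prod_def tensor_classI)
  show "ev (tensor_prod scl m n s t) f = ev s (\<lambda>u. ev t (\<lambda>v. f (u @ v)))" if "multilin (m + n) f"
    using * that by (simp add: tensor_prod_def ev_class lin_ext_lin_ext vector_space_axioms)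
      (simp add: tensor_eval_def)
qed

lemma
  assumes t: "t \<in> tensor_power scl n" and i: "i < n"
    and D: "\<And>a. D a \<in> tensor_power scl 2"
  shows comult_at_closed: "comult_at scl n i D t \<in> tensor_power scl (n + 1)"
    and ev_comult_at: "multilin (n + 1) f \<Longrightarrow> ev (comult_at scl n i D t) f =
      ev t (\<lambda>w. ev (D (w ! i)) (\<lambda>v. f (take i w @ v @ drop (i + 1) w)))"
proof -
  have *: "lin_ext formal_scale
      (\<lambda>w. lin_ext formal_scale (\<lambda>v. word (take i w @ v @ drop (i + 1) w)) (tensor_rep (D (w ! i))))
      (tensor_rep t) \<in> words_space (n + 1)"
    by (intro words_space_lin_ext[OF tensor_rep_words[OF t]]
        words_space_lin_ext[OF tensor_rep_words[OF D]] words_space_word) (use i in auto)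
  then show "comult_at scl n i D t \<in> tensor_power scl (n + 1)"
    by (simp add: comult_at_def tensor_classI)
  show "ev (comult_at scl n i D t) f =
      ev t (\<lambda>w. ev (D (w ! i)) (\<lambda>v. f (take i w @ v @ drop (i + 1) w)))" if "multilin (n + 1) f"
    using * that by (simp add: comult_at_def ev_class lin_ext_lin_ext vector_space_axioms)
      (simp add: tensor_eval_def)
qed

text \<open>
  If the representatives differ by an element outside the span of the multilinearity relations, a linear
  functional that vanishes on the span separates them; on words it is a multilinear function.  Its
  values are moved into the algebra along \<open>c \<mapsto> c \<cdot> 1\<close>, which is injective when \<open>1 \<noteq> 0\<close>.
\<close>

lemma tensor_eqI:
  assumes s: "s \<in> tensor_power scl n" and t: "t \<in> tensor_power scl n"
    and eq: "\<And>f. multilin n f \<Longrightarrow> ev s f = ev t f" and one: "(1::'a) \<noteq> 0"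
  shows "s = t"
proof -
  interpret V: vector_space "formal_scale :: 'k \<Rightarrow> ('a, 'k) formal \<Rightarrow> _" by (rule vector_space_formal)
  let ?U = "V.span (multilinear_rels scl n)"
  have d: "tensor_rep s - tensor_rep t \<in> ?U"
  proof (rule ccontr)
    assume "tensor_rep s - tensor_rep t \<notin> ?U"
    then obtain \<phi> where \<phi>: "Vector_Spaces.linear formal_scale (*) \<phi>"
      "\<forall>u\<in>multilinear_rels scl n. \<phi> u = 0" "\<phi> (tensor_rep s - tensor_rep t) = 1"
      using V.functional_separating_span by blast
    interpret L: Vector_Spaces.linear formal_scale "(*)" \<phi> by fact
    define f where "f w = scl (\<phi> (word w)) (1::'a)" for w
    have "\<phi> (word (u @ (a + b) # v)) = \<phi> (word (u @ a # v)) + \<phi> (word (u @ b # v))"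
      if "length u + 1 + length v = n" for u v :: "'a list" and a b
    proof -
      have "\<phi> (word (u @ (a + b) # v) - word (u @ a # v) - word (u @ b # v)) = 0"
        by (rule \<phi>(2)[THEN bspec]) (unfold multilinear_rels_def, use that in blast)
      then have "\<phi> (word (u @ (a + b) # v)) - \<phi> (word (u @ a # v)) - \<phi> (word (u @ b # v)) = 0"
        by (simp only: L.diff)
      then show ?thesis by (simp add: algebra_simps)
    qed
    moreover have "\<phi> (word (u @ scl c a # v)) = c * \<phi> (word (u @ a # v))"
      if "length u + 1 + length v = n" for u v :: "'a list" and a c
    proof -
      have "\<phi> (word (u @ scl c a # v) - formal_scale c (word (u @ a # v))) = 0"
        by (rule \<phi>(2)[THEN bspec]) (unfold multilinear_rels_def, use that in blast)
      then show ?thesis by (simp add: L.diff L.scale)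
    qed
    ultimately have "multilin n f"
      by (simp add: multilin_def lin_def f_def scale_left_distrib)
    have E: "lin_ext scl f p = scl (\<phi> p) 1" for p
    proof -
      have "\<phi> p = \<phi> (lin_ext formal_scale word p)" by (simp add: lin_ext_word_self)
      then show ?thesis
        by (simp add: lin_ext_def L.sum L.scale f_def scale_sum_left)
    qed
    have "scl (\<phi> (tensor_rep s - tensor_rep t)) 1 = (0::'a)"
      using eq[OF \<open>multilin n f\<close>] by (simp add: tensor_eval_def E L.diff scale_left_diff_distrib)
    then show False using \<phi>(3) one by simp
  qed
  have "q - tensor_rep s \<in> ?U \<longleftrightarrow> q - tensor_rep t \<in> ?U" for q
    using V.span_add[OF _ d, of "q - tensor_rep s"] V.span_diff[OF _ d, of "q - tensor_rep t"] by auto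
  then have "tensor_class scl n (tensor_rep s) = tensor_class scl n (tensor_rep t)"
    by (simp add: tensor_class_def)
  then show ?thesis using s t by (simp add: tensor_class_rep)
qed

end

section \<open>Sweedler sums\<close>

text \<open>
  The list \<open>[(x\<^sub>1, y\<^sub>1), \<dots>]\<close> stands for the tensor \<open>x\<^sub>1 \<otimes> y\<^sub>1 + \<dots>\<close>, and a list of triples for an element
  of the third tensor power.  Nested Sweedler notation becomes a nest of finite sums, which can be
  interchanged freely.
\<close>

definition sw :: "('a \<times> 'a) list \<Rightarrow> ('a \<Rightarrow> 'a \<Rightarrow> 'b) \<Rightarrow> 'b::comm_monoid_add" where
  "sw t f = (\<Sum>(x, y)\<leftarrow>t. f x y)"

definition sw3 :: "('a \<times> 'a \<times> 'a) list \<Rightarrow> ('a \<Rightarrow> 'a \<Rightarrow> 'a \<Rightarrow> 'b) \<Rightarrow> 'b::comm_monoid_add" where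
  "sw3 t f = (\<Sum>(x, y, z)\<leftarrow>t. f x y z)"

lemma sw_Nil [simp]: "sw [] f = 0"
  and sw_Cons [simp]: "sw ((x, y) # t) f = f x y + sw t f"
  by (simp_all add: sw_def)

lemma sw_append [simp]: "sw (s @ t) f = sw s f + sw t f"
  by (simp add: sw_def)

lemma sw3_Nil [simp]: "sw3 [] f = 0"
  and sw3_Cons [simp]: "sw3 ((x, y, z) # t) f = f x y z + sw3 t f"
  by (simp_all add: sw3_def)

lemma sw3_append [simp]: "sw3 (s @ t) f = sw3 s f + sw3 t f"
  by (simp add: sw3_def)

lemma sw_add: "sw t (\<lambda>x y. f x y + g x y) = sw t f + sw t g"
  by (induction t) (auto simp: algebra_simps)

lemma sw_cong: "(\<And>x y. f x y = g x y) \<Longrightarrow> sw t f = sw t g"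
  by (simp add: sw_def)

lemma sw_zero [simp]: "sw t (\<lambda>x y. 0) = 0"
  by (induction t) auto

lemma sw_swap:
  "sw s (\<lambda>x y. sw t (\<lambda>u v. F x y u v)) = sw t (\<lambda>u v. sw s (\<lambda>x y. F x y u v))"
  by (induction s) (auto simp: sw_add)

lemma sw_mult_right: "sw t f * c = sw t (\<lambda>x y. f x y * (c::'b::semiring_0))"
  and sw_mult_left: "c * sw t f = sw t (\<lambda>x y. c * f x y)"
  by (induction t) (auto simp: algebra_simps)

lemma sw_mult: "sw s f * sw t g = sw s (\<lambda>x y. sw t (\<lambda>u v. f x y * (g u v :: 'b::semiring_0)))"
  by (simp only: sw_mult_right) (simp only: sw_mult_left)

lemma sw_flip: "sw (map prod.swap t) f = sw t (\<lambda>x y. f y x)"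
  by (induction t) auto

text \<open>
  On the level of lists the factorwise product is associative and unital on the nose, so a chain of
  equivalences between products of representatives can be manipulated as in a monoid.
\<close>

definition prod2 :: "('a::times \<times> 'a) list \<Rightarrow> ('a \<times> 'a) list \<Rightarrow> ('a \<times> 'a) list" where
  "prod2 s t = concat (map (\<lambda>(x, y). map (\<lambda>(u, v). (x * u, y * v)) t) s)"

definition prod3 :: "('a::times \<times> 'a \<times> 'a) list \<Rightarrow> ('a \<times> 'a \<times> 'a) list \<Rightarrow> ('a \<times> 'a \<times> 'a) list" where
  "prod3 s t = concat (map (\<lambda>(x, y, z). map (\<lambda>(u, v, w). (x * u, y * v, z * w)) t) s)"

definition leg12 :: "('a \<times> 'a) list \<Rightarrow> ('a::one \<times> 'a \<times> 'a) list" where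
  "leg12 t = map (\<lambda>(x, y). (x, y, 1)) t"

definition leg23 :: "('a \<times> 'a) list \<Rightarrow> ('a::one \<times> 'a \<times> 'a) list" where
  "leg23 t = map (\<lambda>(x, y). (1, x, y)) t"

definition comult_left :: "('a \<Rightarrow> ('a \<times> 'a) list) \<Rightarrow> ('a \<times> 'a) list \<Rightarrow> ('a \<times> 'a \<times> 'a) list" where
  "comult_left d t = concat (map (\<lambda>(x, y). map (\<lambda>(u, v). (u, v, y)) (d x)) t)"

definition comult_right :: "('a \<Rightarrow> ('a \<times> 'a) list) \<Rightarrow> ('a \<times> 'a) list \<Rightarrow> ('a \<times> 'a \<times> 'a) list" where
  "comult_right d t = concat (map (\<lambda>(x, y). map (\<lambda>(u, v). (x, u, v)) (d y)) t)"

lemma sw_map: "sw (map (\<lambda>(x, y). (p x y, q x y)) t) f = sw t (\<lambda>x y. f (p x y) (q x y))"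
  by (induction t) auto

lemma sw3_map:
  "sw3 (map (\<lambda>(x, y). (p x y, q x y, r x y)) t) f = sw t (\<lambda>x y. f (p x y) (q x y) (r x y))"
  by (induction t) auto

lemma sw3_map_Pair: "sw3 (map (Pair c) t) f = sw t (f c)"
  by (induction t) auto

lemma sw3_map3:
  "sw3 (map (\<lambda>(x, y, z). (p x y z, q x y z, r x y z)) t) f
    = sw3 t (\<lambda>x y z. f (p x y z) (q x y z) (r x y z))"
  by (induction t) auto

lemma sw_prod2: "sw (prod2 s t) f = sw s (\<lambda>x y. sw t (\<lambda>u v. f (x * u) (y * v)))"
  by (induction s) (auto simp: prod2_def sw_map)

lemma sw3_prod3:
  "sw3 (prod3 s t) f = sw3 s (\<lambda>x y z. sw3 t (\<lambda>u v w. f (x * u) (y * v) (z * w)))"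
  by (induction s) (auto simp: prod3_def sw3_map3)

lemma sw3_leg12: "sw3 (leg12 t) f = sw t (\<lambda>x y. f x y 1)"
  by (simp add: leg12_def sw3_map)

lemma sw3_leg23: "sw3 (leg23 t) f = sw t (\<lambda>x y. f 1 x y)"
  by (simp add: leg23_def sw3_map_Pair)

lemma sw3_comult_left: "sw3 (comult_left d t) f = sw t (\<lambda>x y. sw (d x) (\<lambda>u v. f u v y))"
  by (induction t) (auto simp: comult_left_def sw3_map)

lemma sw3_comult_right: "sw3 (comult_right d t) f = sw t (\<lambda>x y. sw (d y) (\<lambda>u v. f x u v))"
  by (induction t) (auto simp: comult_right_def sw3_map_Pair)

lemmas sw_expand = sw_prod2 sw3_prod3 sw3_leg12 sw3_leg23 sw3_comult_left sw3_comult_right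

lemma prod2_assoc: "prod2 (prod2 r s) t = prod2 r (prod2 s (t :: ('a::semigroup_mult \<times> 'a) list))"
proof -
  have app: "prod2 (r @ r') s = prod2 r s @ prod2 r' s" for r r' s :: "('a \<times> 'a) list"
    by (simp add: prod2_def)
  have one: "prod2 (prod2 [p] s) t = prod2 [p] (prod2 s t)" for p :: "'a \<times> 'a"
    by (induction s) (auto simp: prod2_def mult.assoc o_def case_prod_beta)
  have Nil: "prod2 [] s = []" for s :: "('a \<times> 'a) list" by (simp add: prod2_def)
  show ?thesis
  proof (induction r)
    case (Cons p r)
    have "prod2 (p # r) s = prod2 [p] s @ prod2 r s" for s using app[of "[p]" r s] by simp
    then show ?case using Cons one by (simp add: app)
  qed (simp add: Nil)
qed

lemma prod3_assoc: "prod3 (prod3 r s) t = prod3 r (prod3 s (t :: ('a::semigroup_mult \<times> 'a \<times> 'a) list))"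
proof -
  have app: "prod3 (r @ r') s = prod3 r s @ prod3 r' s" for r r' s :: "('a \<times> 'a \<times> 'a) list"
    by (simp add: prod3_def)
  have one: "prod3 (prod3 [p] s) t = prod3 [p] (prod3 s t)" for p :: "'a \<times> 'a \<times> 'a"
    by (induction s) (auto simp: prod3_def mult.assoc o_def case_prod_beta)
  have Nil: "prod3 [] s = []" for s :: "('a \<times> 'a \<times> 'a) list" by (simp add: prod3_def)
  show ?thesis
  proof (induction r)
    case (Cons p r)
    have "prod3 (p # r) s = prod3 [p] s @ prod3 r s" for s using app[of "[p]" r s] by simp
    then show ?case using Cons one by (simp add: app)
  qed (simp add: Nil)
qed

lemma prod_units [simp]:
  fixes s :: "('a::monoid_mult \<times> 'a) list" and t :: "('a \<times> 'a \<times> 'a) list"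
  shows "prod2 [(1, 1)] s = s" "prod2 s [(1, 1)] = s"
    and "prod3 [(1, 1, 1)] t = t" "prod3 t [(1, 1, 1)] = t"
  by (induction s; induction t; force simp: prod2_def prod3_def)+

text \<open>
  Linearity side conditions are discharged by introduction rules only, which follow the single
  occurrence of the variable down through the expression.
\<close>

named_theorems lin_intro

context k_algebra
begin

definition bilin :: "('a \<Rightarrow> 'a \<Rightarrow> 'a) \<Rightarrow> bool" where
  "bilin f \<longleftrightarrow> (\<forall>y. lin (\<lambda>x. f x y)) \<and> (\<forall>x. lin (\<lambda>y. f x y))"

definition trilin :: "('a \<Rightarrow> 'a \<Rightarrow> 'a \<Rightarrow> 'a) \<Rightarrow> bool" where
  "trilin f \<longleftrightarrow> (\<forall>y z. lin (\<lambda>x. f x y z)) \<and> (\<forall>x z. lin (\<lambda>y. f x y z)) \<and> (\<forall>x y. lin (\<lambda>z. f x y z))"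

lemma bilinI [lin_intro]:
  "(\<And>y. lin (\<lambda>x. f x y)) \<Longrightarrow> (\<And>x. lin (\<lambda>y. f x y)) \<Longrightarrow> bilin f"
  by (simp add: bilin_def)

lemma trilinI [lin_intro]:
  "(\<And>y z. lin (\<lambda>x. f x y z)) \<Longrightarrow> (\<And>x z. lin (\<lambda>y. f x y z)) \<Longrightarrow> (\<And>x y. lin (\<lambda>z. f x y z)) \<Longrightarrow> trilin f"
  by (simp add: trilin_def)

lemma bilinD:
  assumes "bilin f"
  shows "lin (\<lambda>x. f x y)" "lin (\<lambda>y. f x y)"
  using assms by (auto simp: bilin_def)

lemma trilinD:
  assumes "trilin f"
  shows "lin (\<lambda>x. f x y z)" "lin (\<lambda>y. f x y z)" "lin (\<lambda>z. f x y z)"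
  using assms by (auto simp: trilin_def)

lemma lin_id [lin_intro]: "lin (\<lambda>x. x)"
  by (simp add: lin_def)

lemma lin_mult [lin_intro]:
  assumes "lin g"
  shows "lin (\<lambda>x. g x * c)" "lin (\<lambda>x. c * g x)"
  using assms by (simp_all add: lin_def algebra_simps scl_mult_left scl_mult_right)

lemma lin_scl [lin_intro]: "lin g \<Longrightarrow> lin (\<lambda>x. scl c (g x))"
  by (simp add: lin_def scale_right_distrib scale_left_commute)

lemma lin_comp: "lin f \<Longrightarrow> lin g \<Longrightarrow> lin (\<lambda>x. f (g x))"
  by (simp add: lin_def)

lemma sw_scl: "scl c (sw t f) = sw t (\<lambda>x y. scl c (f x y))"
  by (induction t) (auto simp: scale_right_distrib)

lemma sw_scl_left: "scl (sw t f) a = sw t (\<lambda>x y. scl (f x y) a)"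
  by (induction t) (auto simp: scale_left_distrib)

lemma lin_zero: "lin f \<Longrightarrow> f 0 = 0"
  unfolding lin_def by (metis scale_zero_left)

lemma lin_sw: "lin f \<Longrightarrow> f (sw t g) = sw t (\<lambda>x y. f (g x y))"
  by (induction t) (auto simp: lin_zero, auto simp: lin_def)

lemma lin_sw_arg [lin_intro]:
  assumes "\<And>u v. lin (\<lambda>x. F x u v)"
  shows "lin (\<lambda>x. sw t (\<lambda>u v. F x u v))"
  using assms by (induction t) (auto simp: lin_def algebra_simps scale_right_distrib)

lemma lin_sw3_arg [lin_intro]:
  assumes "\<And>u v w. lin (\<lambda>x. F x u v w)"
  shows "lin (\<lambda>x. sw3 t (\<lambda>u v w. F x u v w))"
  using assms by (induction t) (auto simp: lin_def algebra_simps scale_right_distrib)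

definition eq2 :: "('a \<times> 'a) list \<Rightarrow> ('a \<times> 'a) list \<Rightarrow> bool" where
  "eq2 s t \<longleftrightarrow> (\<forall>f. bilin f \<longrightarrow> sw s f = sw t f)"

definition eq3 :: "('a \<times> 'a \<times> 'a) list \<Rightarrow> ('a \<times> 'a \<times> 'a) list \<Rightarrow> bool" where
  "eq3 s t \<longleftrightarrow> (\<forall>f. trilin f \<longrightarrow> sw3 s f = sw3 t f)"

lemma eq2_refl [simp]: "eq2 s s" and eq3_refl [simp]: "eq3 r r"
  by (simp_all add: eq2_def eq3_def)

lemma eq2_sym: "eq2 s t \<Longrightarrow> eq2 t s" and eq3_sym: "eq3 p q \<Longrightarrow> eq3 q p"
  by (simp_all add: eq2_def eq3_def)

lemma eq2_trans [trans]: "eq2 r s \<Longrightarrow> eq2 s t \<Longrightarrow> eq2 r t"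
  and eq3_trans [trans]: "eq3 o' p \<Longrightarrow> eq3 p q \<Longrightarrow> eq3 o' q"
  by (simp_all add: eq2_def eq3_def)

lemma eq2D: "eq2 s t \<Longrightarrow> bilin f \<Longrightarrow> sw s f = sw t f"
  and eq3D: "eq3 p q \<Longrightarrow> trilin g \<Longrightarrow> sw3 p g = sw3 q g"
  by (simp_all add: eq2_def eq3_def)

lemma prod2_cong:
  assumes "eq2 s s'" "eq2 t t'"
  shows "eq2 (prod2 s t) (prod2 s' t')"
  unfolding eq2_def sw_prod2
proof (intro allI impI)
  fix f assume f: "bilin f"
  note [lin_intro] = bilinD[OF f, THEN lin_comp]
  let ?F = "\<lambda>t x y. sw t (\<lambda>u v. f (x * u) (y * v))"
  have "?F t = ?F t'"
    by (intro ext eq2D[OF assms(2)] lin_intro)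
  moreover have "sw s (?F t) = sw s' (?F t)"
    by (intro eq2D[OF assms(1)] lin_intro)
  ultimately show "sw s (?F t) = sw s' (?F t')" by simp
qed

lemma prod3_cong:
  assumes "eq3 s s'" "eq3 t t'"
  shows "eq3 (prod3 s t) (prod3 s' t')"
  unfolding eq3_def sw3_prod3
proof (intro allI impI)
  fix f assume f: "trilin f"
  note [lin_intro] = trilinD[OF f, THEN lin_comp]
  let ?F = "\<lambda>t x y z. sw3 t (\<lambda>u v w. f (x * u) (y * v) (z * w))"
  have "?F t = ?F t'"
    by (intro ext eq3D[OF assms(2)] lin_intro)
  moreover have "sw3 s (?F t) = sw3 s' (?F t)"
    by (intro eq3D[OF assms(1)] lin_intro)
  ultimately show "sw3 s (?F t) = sw3 s' (?F t')" by simp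
qed

text \<open>
  From \<open>a p = b q\<close> it follows that \<open>b\<^sup>-\<^sup>1 a = q p\<^sup>-\<^sup>1\<close>.  Each equation between a twist, its inverse and
  their comultiplications below is an instance of this.
\<close>

lemma eq3_cross:
  assumes "eq3 (prod3 a p) (prod3 b q)" "eq3 (prod3 p p') [(1, 1, 1)]" "eq3 (prod3 b' b) [(1, 1, 1)]"
  shows "eq3 (prod3 b' a) (prod3 q p')"
proof -
  have "eq3 (prod3 (prod3 b' a) [(1, 1, 1)]) (prod3 (prod3 b' a) (prod3 p p'))"
    by (intro prod3_cong eq3_refl eq3_sym[OF assms(2)])
  also have "prod3 (prod3 b' a) (prod3 p p') = prod3 (prod3 b' (prod3 a p)) p'"
    by (simp add: prod3_assoc)
  also have "eq3 \<dots> (prod3 (prod3 b' (prod3 b q)) p')"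
    by (intro prod3_cong eq3_refl assms(1))
  also have "\<dots> = prod3 (prod3 b' b) (prod3 q p')"
    by (simp add: prod3_assoc)
  also have "eq3 \<dots> (prod3 [(1, 1, 1)] (prod3 q p'))"
    by (intro prod3_cong eq3_refl assms(3))
  finally show ?thesis by simp
qed

lemma eq3_move:
  assumes "eq3 (prod3 a p) c" "eq3 (prod3 p p') [(1, 1, 1)]"
  shows "eq3 a (prod3 c p')"
  using eq3_cross[of a p "[(1, 1, 1)]" c p' "[(1, 1, 1)]"] assms by simp

lemma leg_prod:
  fixes s t :: "('a \<times> 'a) list"
  shows "leg12 (prod2 s t) = prod3 (leg12 s) (leg12 t)"
    and "leg23 (prod2 s t) = prod3 (leg23 s) (leg23 t)"
  by (induction s) (auto simp: leg12_def leg23_def prod2_def prod3_def)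

lemma leg_cong:
  assumes "eq2 s t"
  shows "eq3 (leg12 s) (leg12 t)" "eq3 (leg23 s) (leg23 t)"
  unfolding eq3_def sw_expand
  by (intro allI impI eq2D[OF assms] bilinI, erule trilinD, erule trilinD)+

lemma leg_inverse:
  assumes "eq2 (prod2 s t) [(1, 1)]"
  shows "eq3 (prod3 (leg12 s) (leg12 t)) [(1, 1, 1)]" "eq3 (prod3 (leg23 s) (leg23 t)) [(1, 1, 1)]"
  using leg_cong[OF assms] by (simp_all add: leg_prod) (simp_all add: leg12_def leg23_def)

end

section \<open>Sweedler powers in bialgebras\<close>

text \<open>
  \<open>sweedler d m\<close> multiplies \<open>m + 1\<close> legs, so it is the Sweedler power of index \<open>m + 1\<close>.
\<close>

primrec sweedler :: "('a \<Rightarrow> ('a \<times> 'a) list) \<Rightarrow> nat \<Rightarrow> 'a::ring_1 \<Rightarrow> 'a" where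
  "sweedler d 0 a = a"
| "sweedler d (Suc m) a = sw (d a) (\<lambda>x y. sweedler d m x * y)"

locale coalgebra_sums = k_algebra scl
  for scl :: "'k::field \<Rightarrow> 'a::ring_1 \<Rightarrow> 'a" +
  fixes d :: "'a \<Rightarrow> ('a \<times> 'a) list"
  assumes d_lin: "bilin f \<Longrightarrow> lin (\<lambda>a. sw (d a) f)"
    and coassoc: "eq3 (comult_left d (d a)) (comult_right d (d a))"
begin

lemma lin_d [lin_intro]: "lin g \<Longrightarrow> bilin f \<Longrightarrow> lin (\<lambda>x. sw (d (g x)) f)"
  by (rule lin_comp[OF d_lin])

lemma coassocD:
  "trilin g \<Longrightarrow> sw (d a) (\<lambda>x y. sw (d x) (\<lambda>u v. g u v y)) = sw (d a) (\<lambda>x y. sw (d y) (\<lambda>u v. g x u v))"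
  using eq3D[OF coassoc, of g] by (simp add: sw_expand)

lemma lin_sweedler: "lin (sweedler d m)"
  by (induction m) (auto simp: fun_eq_iff intro!: lin_intro intro: lin_comp)

lemma lin_sweedler_comp [lin_intro]: "lin g \<Longrightarrow> lin (\<lambda>x. sweedler d m (g x))"
  by (rule lin_comp[OF lin_sweedler])

lemma sweedler_Suc_left: "sweedler d (Suc m) a = sw (d a) (\<lambda>x y. x * sweedler d m y)"
proof (induction m arbitrary: a)
  case (Suc m)
  have "sweedler d (Suc (Suc m)) a = sw (d a) (\<lambda>x y. sw (d x) (\<lambda>u v. u * sweedler d m v * y))"
    by (subst sweedler.simps(2), intro sw_cong, subst Suc) (simp add: sw_mult_right)
  also have "\<dots> = sw (d a) (\<lambda>x y. sw (d y) (\<lambda>u v. x * sweedler d m u * v))"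
    by (intro coassocD lin_intro)
  finally show ?case by (simp add: sw_mult_left mult.assoc)
qed simp

lemma comult_cong:
  assumes "eq2 s t"
  shows "eq3 (comult_left d s) (comult_left d t)" "eq3 (comult_right d s) (comult_right d t)"
  unfolding eq3_def sw_expand
  by (intro allI impI eq2D[OF assms] lin_intro; erule trilinD)+

end

locale bialgebra_sums = coalgebra_sums scl d
  for scl :: "'k::field \<Rightarrow> 'a::ring_1 \<Rightarrow> 'a" and d +
  fixes \<epsilon> :: "'a \<Rightarrow> 'k"
  assumes d_mult: "eq2 (d (a * b)) (prod2 (d a) (d b))"
    and d_one: "eq2 (d 1) [(1, 1)]"
    and counit: "algebra_character scl \<epsilon>"
    and counit_left: "sw (d a) (\<lambda>x y. scl (\<epsilon> x) y) = a"
    and counit_right: "sw (d a) (\<lambda>x y. scl (\<epsilon> y) x) = a"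
begin

lemma d_multD: "bilin f \<Longrightarrow> sw (d (a * b)) f = sw (d a) (\<lambda>x y. sw (d b) (\<lambda>u v. f (x * u) (y * v)))"
  using eq2D[OF d_mult] by (simp add: sw_prod2)

lemma comult_prod:
  shows "eq3 (comult_left d (prod2 s t)) (prod3 (comult_left d s) (comult_left d t))"
    and "eq3 (comult_right d (prod2 s t)) (prod3 (comult_right d s) (comult_right d t))"
proof -
  have "sw s (\<lambda>x y. sw t (\<lambda>u v. sw (d (x * u)) (\<lambda>p q. f p q (y * v)))) =
      sw s (\<lambda>x y. sw (d x) (\<lambda>p q. sw t (\<lambda>u v. sw (d u) (\<lambda>p' q'. f (p * p') (q * q') (y * v)))))"
    if "trilin f" for f
    by (subst d_multD) (auto intro!: lin_intro intro: trilinD[OF that] simp: sw_swap[of "d _" t])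
  then show "eq3 (comult_left d (prod2 s t)) (prod3 (comult_left d s) (comult_left d t))"
    by (simp add: eq3_def sw_expand)
  have "sw s (\<lambda>x y. sw t (\<lambda>u v. sw (d (y * v)) (\<lambda>p q. f (x * u) p q))) =
      sw s (\<lambda>x y. sw (d y) (\<lambda>p q. sw t (\<lambda>u v. sw (d v) (\<lambda>p' q'. f (x * u) (p * p') (q * q')))))"
    if "trilin f" for f
    by (subst d_multD) (auto intro!: lin_intro intro: trilinD[OF that] simp: sw_swap[of "d _" t])
  then show "eq3 (comult_right d (prod2 s t)) (prod3 (comult_right d s) (comult_right d t))"
    by (simp add: eq3_def sw_expand)
qed

lemma comult_inverse:
  assumes "eq2 (prod2 s t) [(1, 1)]"
  shows "eq3 (prod3 (comult_left d s) (comult_left d t)) [(1, 1, 1)]"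
    and "eq3 (prod3 (comult_right d s) (comult_right d t)) [(1, 1, 1)]"
proof -
  have "eq3 (comult_left d [(1, 1)]) [(1, 1, 1)]" "eq3 (comult_right d [(1, 1)]) [(1, 1, 1)]"
    unfolding eq3_def sw_expand using trilinD eq2D[OF d_one] by (auto simp: bilin_def)
  then show "eq3 (prod3 (comult_left d s) (comult_left d t)) [(1, 1, 1)]"
    and "eq3 (prod3 (comult_right d s) (comult_right d t)) [(1, 1, 1)]"
    using comult_cong[OF assms] comult_prod[of s t] by (meson eq3_trans eq3_sym)+
qed

text \<open>
  Both sides are the interleaved product \<open>b\<^sub>1 a\<^sub>1 b\<^sub>2 a\<^sub>2 \<dots> a\<^sub>m\<^sub>+\<^sub>1 b\<^sub>m\<^sub>+\<^sub>2\<close>.  The induction splits off the last leg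
  of \<open>a\<close>, and coassociativity supplies the additional leg of \<open>b\<close>.
\<close>

lemma sweedler_shift:
  "sw (d b) (\<lambda>x y. x * sweedler d m (a * y)) = sw (d b) (\<lambda>x y. sweedler d m (x * a) * y)"
proof (induction m arbitrary: a b)
  case (Suc m)
  have "sw (d b) (\<lambda>x y. x * sweedler d (Suc m) (a * y)) =
      sw (d b) (\<lambda>x y. sw (d a) (\<lambda>p q. sw (d y) (\<lambda>u v. x * sweedler d m (p * u) * (q * v))))"
    by (simp, subst d_multD) (intro lin_intro, simp add: sw_mult_left mult.assoc)
  also have "\<dots> = sw (d a) (\<lambda>p q. sw (d b) (\<lambda>x y. sw (d y) (\<lambda>u v. x * sweedler d m (p * u) * (q * v))))"
    by (rule sw_swap)
  also have "\<dots> = sw (d a) (\<lambda>p q. sw (d b) (\<lambda>x y. sw (d x) (\<lambda>u v. u * sweedler d m (p * v) * (q * y))))"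
    by (intro arg_cong[of _ _ "sw (d a)"] ext coassocD[symmetric] lin_intro)
  also have "\<dots> = sw (d a) (\<lambda>p q. sw (d b) (\<lambda>x y. sw (d x) (\<lambda>u v. sweedler d m (u * p) * v) * (q * y)))"
    by (simp only: sw_mult_right[symmetric] Suc)
  also have "\<dots> = sw (d b) (\<lambda>x y. sw (d a) (\<lambda>p q. sw (d x) (\<lambda>u v. sweedler d m (u * p) * v) * (q * y)))"
    by (rule sw_swap)
  also have "\<dots> = sw (d b) (\<lambda>x y. sw (d x) (\<lambda>u v. sw (d a) (\<lambda>p q. sweedler d m (u * p) * (v * q))) * y)"
    by (simp add: sw_mult_right mult.assoc sw_swap[of "d a"])
  also have "\<dots> = sw (d b) (\<lambda>x y. sweedler d (Suc m) (x * a) * y)"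
    by (simp, subst d_multD) (intro lin_intro, simp)
  finally show ?case .
qed (auto intro!: sw_cong simp: mult.assoc)

end

section \<open>Twists of bialgebras\<close>

locale twist_sums = bialgebra_sums scl d \<epsilon>
  for scl :: "'k::field \<Rightarrow> 'a::ring_1 \<Rightarrow> 'a" and d \<epsilon> +
  fixes J K :: "('a \<times> 'a) list"
  assumes JK: "eq2 (prod2 J K) [(1, 1)]" and KJ: "eq2 (prod2 K J) [(1, 1)]"
    and twist: "eq3 (prod3 (comult_left d J) (leg12 J)) (prod3 (comult_right d J) (leg23 J))"
    and J_left: "sw J (\<lambda>x y. scl (\<epsilon> x) y) = 1"
    and J_right: "sw J (\<lambda>x y. scl (\<epsilon> y) x) = 1"
begin

lemmas comult_JK = comult_inverse[OF JK] and comult_KJ = comult_inverse[OF KJ]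
lemmas leg_JK = leg_inverse[OF JK] and leg_KJ = leg_inverse[OF KJ]

text \<open>
  The twist equation relates four invertible elements of the third tensor power.  The following
  variants isolate those of its consequences in which \<open>J\<close> and \<open>K\<close> occur together, and those that express
  a comultiplied leg of \<open>J\<close> or \<open>K\<close> by the other one.
\<close>

lemma mixed_right_left: "eq3 (prod3 (comult_right d K) (comult_left d J)) (prod3 (leg23 J) (leg12 K))"
  by (rule eq3_cross[OF twist leg_JK(1) comult_KJ(2)])

lemma mixed_left_right: "eq3 (prod3 (comult_left d K) (comult_right d J)) (prod3 (leg12 J) (leg23 K))"
  by (rule eq3_cross[OF eq3_sym[OF twist] leg_JK(2) comult_KJ(1)])

lemma twist_inverse: "eq3 (prod3 (leg23 K) (comult_right d K)) (prod3 (leg12 K) (comult_left d K))"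
  by (rule eq3_cross[OF mixed_right_left comult_JK(1) leg_KJ(2)])

lemma comult_right_K: "eq3 (comult_right d K) (prod3 (leg23 J) (prod3 (leg12 K) (comult_left d K)))"
  using eq3_move[OF mixed_right_left comult_JK(1)] by (simp add: prod3_assoc)

lemma comult_left_J: "eq3 (comult_left d J) (prod3 (comult_right d J) (prod3 (leg23 J) (leg12 K)))"
  using eq3_move[OF twist leg_JK(1)] by (simp add: prod3_assoc)

lemma comult_right_J: "eq3 (comult_right d J) (prod3 (comult_left d J) (prod3 (leg12 J) (leg23 K)))"
  using eq3_move[OF eq3_sym[OF twist] leg_JK(2)] by (simp add: prod3_assoc)

definition d_twisted :: "'a \<Rightarrow> ('a \<times> 'a) list" where
  "d_twisted a = prod2 (prod2 K (d a)) J"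

lemma sw_d_twisted: "sw (d_twisted a) f = sw K (\<lambda>k l. sw (d a) (\<lambda>x y. sw J (\<lambda>i j. f (k * x * i) (l * y * j))))"
  by (simp add: d_twisted_def sw_prod2)

text \<open>
  The two iterated twisted comultiplications are the untwisted ones, multiplied on the right by the two
  sides of the twist equation and on the left by the two sides of its inverse.
\<close>

sublocale twisted: coalgebra_sums scl d_twisted
proof
  show "lin (\<lambda>a. sw (d_twisted a) f)" if "bilin f" for f
  proof -
    note [lin_intro] = bilinD[OF that, THEN lin_comp]
    show ?thesis unfolding sw_d_twisted by (intro lin_intro)
  qed
  fix a
  have lft: "sw3 (comult_left d_twisted t) f = sw3 (prod3 (leg12 K) (prod3 (comult_left d t) (leg12 J))) f"
    for t and f :: "'a \<Rightarrow> 'a \<Rightarrow> 'a \<Rightarrow> 'a"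
    by (simp add: sw_expand sw_d_twisted mult.assoc) (rule sw_swap)
  have rgt: "sw3 (comult_right d_twisted t) f = sw3 (prod3 (leg23 K) (prod3 (comult_right d t) (leg23 J))) f"
    for t and f :: "'a \<Rightarrow> 'a \<Rightarrow> 'a \<Rightarrow> 'a"
    by (simp add: sw_expand sw_d_twisted mult.assoc) (rule sw_swap)
  have L: "eq3 (comult_left d (d_twisted a))
      (prod3 (comult_left d K) (prod3 (comult_left d (d a)) (comult_left d J)))"
    unfolding d_twisted_def prod2_assoc by (meson comult_prod(1) prod3_cong eq3_refl eq3_trans)
  have R: "eq3 (comult_right d (d_twisted a))
      (prod3 (comult_right d K) (prod3 (comult_right d (d a)) (comult_right d J)))"
    unfolding d_twisted_def prod2_assoc by (meson comult_prod(2) prod3_cong eq3_refl eq3_trans)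
  have "eq3 (comult_left d_twisted (d_twisted a)) (prod3 (leg12 K) (prod3 (comult_left d (d_twisted a)) (leg12 J)))"
    by (simp add: eq3_def lft)
  also have "eq3 \<dots> (prod3 (leg12 K) (prod3
      (prod3 (comult_left d K) (prod3 (comult_left d (d a)) (comult_left d J))) (leg12 J)))"
    by (intro prod3_cong eq3_refl L)
  also have "\<dots> = prod3 (prod3 (leg12 K) (comult_left d K))
      (prod3 (comult_left d (d a)) (prod3 (comult_left d J) (leg12 J)))"
    by (simp only: prod3_assoc)
  also have "eq3 \<dots> (prod3 (prod3 (leg23 K) (comult_right d K))
      (prod3 (comult_right d (d a)) (prod3 (comult_right d J) (leg23 J))))"
    by (intro prod3_cong coassoc twist eq3_sym[OF twist_inverse])
  also have "\<dots> = prod3 (leg23 K) (prod3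
      (prod3 (comult_right d K) (prod3 (comult_right d (d a)) (comult_right d J))) (leg23 J))"
    by (simp only: prod3_assoc)
  also have "eq3 \<dots> (prod3 (leg23 K) (prod3 (comult_right d (d_twisted a)) (leg23 J)))"
    by (intro prod3_cong eq3_refl eq3_sym[OF R])
  also have "eq3 \<dots> (comult_right d_twisted (d_twisted a))"
    by (simp add: eq3_def rgt)
  finally show "eq3 (comult_left d_twisted (d_twisted a)) (comult_right d_twisted (d_twisted a))" .
qed

text \<open>
  After the comultiplied second leg of \<open>K\<close> is replaced by \<open>J\<close>, \<open>K\<close> and a comultiplied first leg,
  \<open>sweedler_shift\<close> moves that first leg in front of the inner power, where the induction hypothesis
  applies with \<open>r p i\<close> in the role of \<open>a\<close>.  What remains around the inner power is one step of the
  twisted comultiplication.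
\<close>

lemma sweedler_twist:
  "sw K (\<lambda>k l. k * sweedler d m (a * l)) = sw K (\<lambda>k l. sweedler d_twisted m (k * a) * l)"
proof (induction m arbitrary: a)
  case (Suc m)
  \<comment> \<open>Two copies of \<open>K\<close> occur below; giving one of them its own name allows their sums to be interchanged one way only.\<close>
  define L where "L = K"
  define g where "g p q x y z = x * sweedler d m (p * y) * (q * z)" for p q x y z
  have g: "trilin (g p q)" for p q
    unfolding g_def by (intro lin_intro)
  have "sw K (\<lambda>k l. k * sweedler d (Suc m) (a * l)) =
      sw K (\<lambda>k l. sw (d a) (\<lambda>p q. sw (d l) (\<lambda>u v. g p q k u v)))"
    unfolding g_def by (simp, subst d_multD) (intro lin_intro, simp add: sw_mult_left mult.assoc)
  also have "\<dots> = sw (d a) (\<lambda>p q. sw3 (comult_right d K) (g p q))"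
    by (simp only: sw_expand) (rule sw_swap)
  also have "\<dots> = sw (d a) (\<lambda>p q. sw3 (prod3 (leg23 J) (prod3 (leg12 K) (comult_left d L))) (g p q))"
    using comult_right_K by (intro sw_cong eq3D g) (simp add: L_def)
  also have "\<dots> = sw (d a) (\<lambda>p q. sw J (\<lambda>i j. sw K (\<lambda>k l. sw L (\<lambda>k' l'.
      k * sw (d k') (\<lambda>r s. r * sweedler d m ((p * i * l) * s)) * (q * j * l')))))"
    unfolding sw_expand g_def
    by (intro sw_cong) (simp add: sw_mult_left sw_mult_right mult.assoc)
  also have "\<dots> = sw (d a) (\<lambda>p q. sw J (\<lambda>i j. sw K (\<lambda>k l. sw L (\<lambda>k' l'.
      sw (d k') (\<lambda>r s. k * sweedler d m ((r * p * i) * l) * (s * q * j * l'))))))"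
    unfolding sweedler_shift
    by (intro sw_cong) (simp add: sw_mult_left sw_mult_right mult.assoc)
  also have "\<dots> = sw (d a) (\<lambda>p q. sw J (\<lambda>i j. sw L (\<lambda>k' l'. sw (d k') (\<lambda>r s.
      sw K (\<lambda>k l. k * sweedler d m ((r * p * i) * l)) * (s * q * j * l')))))"
    by (simp only: sw_mult_right sw_swap[of K L] sw_swap[of K "d y" for y])
  also have "\<dots> = sw (d a) (\<lambda>p q. sw J (\<lambda>i j. sw L (\<lambda>k' l'. sw (d k') (\<lambda>r s.
      sw K (\<lambda>k l. sweedler d_twisted m (k * r * p * i) * (l * s * q * j * l'))))))"
    unfolding Suc by (simp add: sw_mult_right mult.assoc)
  also have "\<dots> = sw L (\<lambda>k' l'. sw (d a) (\<lambda>p q. sw (d k') (\<lambda>r s. sw J (\<lambda>i j.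
      sw K (\<lambda>k l. sweedler d_twisted m (k * r * p * i) * (l * s * q * j * l'))))))"
    by (simp only: sw_swap[of J L] sw_swap[of "d y" L for y] sw_swap[of J "d y" for y])
  also have "\<dots> = sw L (\<lambda>k' l'. sw K (\<lambda>k l. sw (d k') (\<lambda>r s. sw (d a) (\<lambda>p q. sw J (\<lambda>i j.
      sweedler d_twisted m (k * r * p * i) * (l * s * q * j * l'))))))"
    by (subst sw_swap[of "d a"]) (simp only: sw_swap[of J K] sw_swap[of "d y" K for y])
  also have "\<dots> = sw L (\<lambda>k' l'. sw K (\<lambda>k l. sw (d (k' * a)) (\<lambda>x y. sw J (\<lambda>i j.
      sweedler d_twisted m (k * x * i) * (l * y * j))))  * l')"
    by (intro sw_cong, subst d_multD)
      (intro lin_intro twisted.lin_sweedler_comp, simp add: sw_mult_right mult.assoc)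
  also have "\<dots> = sw K (\<lambda>k l. sweedler d_twisted (Suc m) (k * a) * l)"
    by (simp add: L_def sw_d_twisted)
  finally show ?case .
qed (auto intro!: sw_cong simp: mult.assoc)

end

section \<open>The co-opposite bialgebra\<close>

abbreviation flip :: "('a \<times> 'a) list \<Rightarrow> ('a \<times> 'a) list" where
  "flip \<equiv> map prod.swap"

lemma prod2_flip: "prod2 (flip s) (flip t) = flip (prod2 s t)"
  by (simp add: prod2_def map_concat o_def case_prod_beta)

lemma sw3_flip:
  "sw3 (comult_left (\<lambda>a. flip (d a)) (flip t)) f = sw3 (comult_right d t) (\<lambda>x y z. f z y x)"
  "sw3 (comult_right (\<lambda>a. flip (d a)) (flip t)) f = sw3 (comult_left d t) (\<lambda>x y z. f z y x)"
  "sw3 (leg12 (flip t)) f = sw3 (leg23 t) (\<lambda>x y z. f z y x)"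
  "sw3 (leg23 (flip t)) f = sw3 (leg12 t) (\<lambda>x y z. f z y x)"
  by (simp_all add: sw_expand sw_flip)

context k_algebra
begin

lemma bilin_flip: "bilin f \<Longrightarrow> bilin (\<lambda>x y. f y x)"
  by (simp add: bilin_def)

lemma trilin_flip: "trilin f \<Longrightarrow> trilin (\<lambda>x y z. f z y x)"
  by (simp add: trilin_def)

lemma eq2_flip: "eq2 s t \<Longrightarrow> eq2 (flip s) (flip t)"
  by (simp add: eq2_def sw_flip bilin_flip)

end

context twist_sums
begin

lemma K_left: "sw K (\<lambda>k l. scl (\<epsilon> k) l) = 1"
proof -
  have \<epsilon>: "Vector_Spaces.linear scl (*) \<epsilon>" "\<epsilon> 1 = 1" "\<epsilon> (a * b) = \<epsilon> a * \<epsilon> b" for a b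
    using counit by (auto simp: algebra_character_def)
  interpret Vector_Spaces.linear scl "(*)" \<epsilon> by fact
  have "bilin (\<lambda>x y. scl (\<epsilon> x) y)"
    by (intro bilinI) (simp_all add: lin_def add scale scale_left_distrib scale_right_distrib scale_left_commute)
  from eq2D[OF JK this]
  have "sw J (\<lambda>i j. sw K (\<lambda>k l. scl (\<epsilon> i) j * scl (\<epsilon> k) l)) = 1"
    by (simp add: sw_prod2 \<epsilon> scl_mult_left scl_mult_right mult.commute)
  then have "sw J (\<lambda>i j. scl (\<epsilon> i) j) * sw K (\<lambda>k l. scl (\<epsilon> k) l) = 1"
    by (simp only: sw_mult)
  then show ?thesis by (simp add: J_left)
qed

text \<open>
  Reversing all legs exchanges the two sides of the twist equation, so \<open>J\<close> flipped is a twist of the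
  co-opposite bialgebra.
\<close>

lemma twist_sums_flip: "twist_sums scl (\<lambda>a. flip (d a)) \<epsilon> (flip J) (flip K)"
proof
  show "lin (\<lambda>a. sw (flip (d a)) f)" if "bilin f" for f
    unfolding sw_flip by (rule d_lin[OF bilin_flip[OF that]])
  show "eq3 (comult_left (\<lambda>a. flip (d a)) (flip (d a))) (comult_right (\<lambda>a. flip (d a)) (flip (d a)))" for a
    by (simp add: eq3_def sw3_flip trilin_flip eq3D[OF coassoc])
  show "eq2 (flip (d (a * b))) (prod2 (flip (d a)) (flip (d b)))" for a b
    unfolding prod2_flip by (rule eq2_flip[OF d_mult])
  show "eq2 (flip (d 1)) [(1, 1)]" "eq2 (prod2 (flip J) (flip K)) [(1, 1)]" "eq2 (prod2 (flip K) (flip J)) [(1, 1)]"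
    unfolding prod2_flip using eq2_flip[OF d_one] eq2_flip[OF JK] eq2_flip[OF KJ] by simp_all
  show "eq3 (prod3 (comult_left (\<lambda>a. flip (d a)) (flip J)) (leg12 (flip J)))
      (prod3 (comult_right (\<lambda>a. flip (d a)) (flip J)) (leg23 (flip J)))"
    unfolding eq3_def sw3_prod3 sw3_flip
  proof (intro allI impI)
    fix f assume "trilin f"
    from eq3D[OF twist trilin_flip[OF this]]
    show "sw3 (comult_right d J) (\<lambda>x y z. sw3 (leg23 J) (\<lambda>u v w. f (z * w) (y * v) (x * u))) =
        sw3 (comult_left d J) (\<lambda>x y z. sw3 (leg12 J) (\<lambda>u v w. f (z * w) (y * v) (x * u)))"
      by (simp add: sw3_prod3)
  qed
qed (simp_all add: sw_flip counit counit_left counit_right J_left J_right)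

lemma d_twisted_flip: "twist_sums.d_twisted (\<lambda>a. flip (d a)) (flip J) (flip K) a = flip (d_twisted a)"
  by (simp add: twist_sums.d_twisted_def[OF twist_sums_flip] d_twisted_def prod2_flip)

end

section \<open>Hopf algebras\<close>

locale hopf_sums = bialgebra_sums scl d \<epsilon>
  for scl :: "'k::field \<Rightarrow> 'a::ring_1 \<Rightarrow> 'a" and d \<epsilon> +
  fixes S :: "'a \<Rightarrow> 'a"
  assumes lin_S: "lin S"
    and S_left: "sw (d a) (\<lambda>x y. S x * y) = scl (\<epsilon> a) 1"
    and S_right: "sw (d a) (\<lambda>x y. x * S y) = scl (\<epsilon> a) 1"

context k_algebra
begin

abbreviation functional :: "('a \<Rightarrow> 'k) \<Rightarrow> bool" where
  "functional \<equiv> Vector_Spaces.linear scl (*)"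

lemma functionalD:
  assumes "functional f"
  shows "f (x + y) = f x + f y" "f (scl c x) = c * f x" "f 0 = 0" "f (sw t g) = sw t (\<lambda>x y. f (g x y))"
proof -
  interpret Vector_Spaces.linear scl "(*)" f by fact
  show "f (x + y) = f x + f y" "f (scl c x) = c * f x" "f 0 = 0"
    by (simp_all add: add scale zero)
  show "f (sw t g) = sw t (\<lambda>x y. f (g x y))"
    by (induction t) (auto simp: add zero)
qed

lemma functionalI:
  assumes "\<And>x y. f (x + y) = f x + f y" "\<And>c x. f (scl c x) = c * f x"
  shows "functional f"
  by (intro Vector_Spaces.linear_iff[THEN iffD2] conjI allI assms vector_space_axioms)
    (unfold_locales, auto simp: algebra_simps)

lemma lin_functional:
  assumes "functional f" "lin g"
  shows "lin (\<lambda>x. scl (f (g x)) c)"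
  using assms(2) by (simp add: lin_def functionalD[OF assms(1)] scale_left_distrib)

lemma functional_lin:
  assumes "functional f" "lin g"
  shows "functional (\<lambda>x. f (g x))"
  using assms(2) by (intro functionalI) (simp_all add: lin_def functionalD[OF assms(1)])

lemma characterD:
  assumes "algebra_character scl f"
  shows "functional f" "f 1 = 1" "f (x * y) = f x * f y"
  using assms by (auto simp: algebra_character_def)

end

context bialgebra_sums
begin

lemmas counitD = characterD[OF counit]
lemmas lin_counit [lin_intro] = lin_functional[OF counitD(1)]

lemma counit_left_lin: "lin h \<Longrightarrow> sw (d a) (\<lambda>x y. scl (\<epsilon> x) (h y)) = h a"
  using lin_sw[of h "d a" "\<lambda>x y. scl (\<epsilon> x) y"] by (simp add: counit_left lin_def)

lemma counit_right_lin: "lin h \<Longrightarrow> sw (d a) (\<lambda>x y. scl (\<epsilon> y) (h x)) = h a"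
  using lin_sw[of h "d a" "\<lambda>x y. scl (\<epsilon> y) x"] by (simp add: counit_right lin_def)

end

context hopf_sums
begin

lemma lin_S_comp [lin_intro]: "lin g \<Longrightarrow> lin (\<lambda>x. S (g x))"
  by (rule lin_comp[OF lin_S])

lemma S_scl: "S (scl c x) = scl c (S x)"
  using lin_S by (simp add: lin_def)

lemma S_sw: "S (sw t f) = sw t (\<lambda>x y. S (f x y))"
  by (rule lin_sw[OF lin_S])

lemma S_one: "S 1 = 1"
proof -
  have "sw (d 1) (\<lambda>x y. S x * y) = sw [(1, 1)] (\<lambda>x y. S x * y)"
    by (intro eq2D[OF d_one] lin_intro)
  then show ?thesis by (simp add: S_left counitD)
qed

text \<open>
  The element \<open>S(b\<^sub>1) S(a\<^sub>1) a\<^sub>2 b\<^sub>2 S(a\<^sub>3 b\<^sub>3)\<close> collapses to \<open>S(b) S(a)\<close> when the last three factors are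
  combined and to \<open>S(a b)\<close> when the first four are.
\<close>

lemma S_mult: "S (a * b) = S b * S a"
proof -
  have "S b * S a = sw (d a) (\<lambda>x y. sw (d b) (\<lambda>p q. S p * S x * scl (\<epsilon> (y * q)) 1))"
  proof -
    have "S b * S a = sw (d b) (\<lambda>p q. scl (\<epsilon> q) (S p)) * sw (d a) (\<lambda>x y. scl (\<epsilon> y) (S x))"
      by (simp add: counit_right_lin lin_S)
    then show ?thesis
      unfolding sw_mult by (subst sw_swap) (simp add: counitD scl_mult_left scl_mult_right mult.commute)
  qed
  also have "\<dots> = sw (d a) (\<lambda>x y. sw (d y) (\<lambda>y1 y2. sw (d b) (\<lambda>p q. sw (d q) (\<lambda>q1 q2.
      S p * S x * (y1 * q1 * S (y2 * q2))))))"
    unfolding S_right[symmetric]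
    by (intro sw_cong, subst d_multD, intro lin_intro) (simp add: sw_mult_left, rule sw_swap)
  also have "\<dots> = sw (d a) (\<lambda>x y. sw (d x) (\<lambda>x1 x2. sw (d b) (\<lambda>p q. sw (d q) (\<lambda>q1 q2.
      S p * S x1 * (x2 * q1 * S (y * q2))))))"
    by (rule coassocD[symmetric]) (intro lin_intro)
  also have "\<dots> = sw (d a) (\<lambda>x y. sw (d x) (\<lambda>x1 x2. sw (d b) (\<lambda>p q. sw (d p) (\<lambda>p1 p2.
      S p1 * S x1 * (x2 * p2 * S (y * q))))))"
    by (intro sw_cong coassocD[symmetric] lin_intro)
  also have "\<dots> = sw (d a) (\<lambda>x y. sw (d b) (\<lambda>p q. sw (d p) (\<lambda>p1 p2.
      S p1 * sw (d x) (\<lambda>x1 x2. S x1 * x2) * (p2 * S (y * q)))))"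
    by (intro sw_cong, subst sw_swap, intro sw_cong, subst sw_swap)
      (simp add: sw_mult_left sw_mult_right mult.assoc)
  also have "\<dots> = sw (d a) (\<lambda>x y. scl (\<epsilon> x) (sw (d b) (\<lambda>p q. sw (d p) (\<lambda>p1 p2. S p1 * p2 * S (y * q)))))"
    by (simp only: S_left scl_mult_left scl_mult_right sw_scl mult_1_right mult.assoc)
  also have "\<dots> = sw (d a) (\<lambda>x y. scl (\<epsilon> x) (sw (d b) (\<lambda>p q. scl (\<epsilon> p) (S (y * q)))))"
    by (simp only: sw_mult_right[symmetric] S_left scl_mult_left mult_1_left)
  also have "\<dots> = S (a * b)"
    by (subst counit_left_lin, intro lin_intro)+ simp
  finally show ?thesis by simp
qed

lemma counit_S: "\<epsilon> (S a) = \<epsilon> a"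
proof -
  have "\<epsilon> a = \<epsilon> (sw (d a) (\<lambda>x y. S x * y))"
    by (simp add: S_left counitD functionalD)
  also have "\<dots> = \<epsilon> (S (sw (d a) (\<lambda>x y. scl (\<epsilon> y) x)))"
    by (simp add: functionalD[OF counitD(1)] counitD S_sw S_scl mult.commute)
  finally show ?thesis by (simp add: counit_right)
qed

end

section \<open>The algebra endomorphism of a character\<close>

locale hopf_character = hopf_sums scl d \<epsilon> S
  for scl :: "'k::field \<Rightarrow> 'a::ring_1 \<Rightarrow> 'a" and d \<epsilon> S +
  fixes \<alpha> :: "'a \<Rightarrow> 'k"
  assumes character: "algebra_character scl \<alpha>"
begin

lemmas \<alpha>D = characterD[OF character]
lemmas lin_\<alpha> [lin_intro] = lin_functional[OF \<alpha>D(1)]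

definition act :: "'a \<Rightarrow> 'a" where
  "act a = sw (d a) (\<lambda>x y. scl (\<alpha> y) x)"

lemma lin_act: "lin act"
  unfolding act_def by (intro lin_intro)

lemma lin_act_comp [lin_intro]: "lin g \<Longrightarrow> lin (\<lambda>x. act (g x))"
  by (rule lin_comp[OF lin_act])

lemma act_mult: "act (a * b) = act a * act b"
  unfolding act_def
  by (subst d_multD, intro lin_intro)
    (simp add: \<alpha>D sw_mult scl_mult_left scl_mult_right mult.commute)

lemma act_one: "act 1 = 1"
proof -
  have "sw (d 1) (\<lambda>x y. scl (\<alpha> y) x) = sw [(1, 1)] (\<lambda>x y. scl (\<alpha> y) x)"
    by (intro eq2D[OF d_one] lin_intro)
  then show ?thesis by (simp add: act_def \<alpha>D)
qed

lemma S_act: "sw (d a) (\<lambda>x y. S x * act y) = scl (\<alpha> a) 1"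
proof -
  have "sw (d a) (\<lambda>x y. S x * act y) = sw (d a) (\<lambda>x y. sw (d y) (\<lambda>u v. scl (\<alpha> v) (S x * u)))"
    by (simp add: act_def sw_mult_left scl_mult_right)
  also have "\<dots> = sw (d a) (\<lambda>x y. sw (d x) (\<lambda>u v. scl (\<alpha> y) (S u * v)))"
    by (rule coassocD[symmetric]) (intro lin_intro)
  also have "\<dots> = sw (d a) (\<lambda>x y. scl (\<epsilon> x) (scl (\<alpha> y) 1))"
    by (simp add: sw_scl[symmetric] S_left mult.commute)
  also have "\<dots> = scl (\<alpha> a) 1"
    by (subst counit_left_lin, intro lin_intro) simp
  finally show ?thesis .
qed

lemma \<alpha>_S: "sw (d a) (\<lambda>x y. scl (\<alpha> (S x)) (scl (\<alpha> y) c)) = scl (\<epsilon> a) c"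
  "sw (d a) (\<lambda>x y. scl (\<alpha> x) (scl (\<alpha> (S y)) c)) = scl (\<epsilon> a) c"
proof -
  have "\<alpha> (sw (d a) (\<lambda>x y. S x * y)) = \<epsilon> a" "\<alpha> (sw (d a) (\<lambda>x y. x * S y)) = \<epsilon> a"
    by (simp_all add: S_left S_right \<alpha>D functionalD)
  then show "sw (d a) (\<lambda>x y. scl (\<alpha> (S x)) (scl (\<alpha> y) c)) = scl (\<epsilon> a) c"
    "sw (d a) (\<lambda>x y. scl (\<alpha> x) (scl (\<alpha> (S y)) c)) = scl (\<epsilon> a) c"
    by (simp_all add: functionalD[OF \<alpha>D(1)] \<alpha>D sw_scl_left[symmetric])
qed

text \<open>
  Both sides are convolution inverses of \<open>act\<close>.  This replaces the anti-comultiplicativity of the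
  antipode, of which only this trace under \<open>\<alpha>\<close> matters.
\<close>

lemma act_S: "act (S a) = sw (d a) (\<lambda>x y. scl (\<alpha> (S x)) (S y))"
proof -
  define \<psi> where "\<psi> a = sw (d a) (\<lambda>x y. scl (\<alpha> (S x)) (S y))" for a
  have lin_\<psi>: "lin \<psi>" unfolding \<psi>_def by (intro lin_intro)
  note [lin_intro] = lin_comp[OF lin_\<psi>]
  have inv: "sw (d a) (\<lambda>x y. \<psi> x * act y) = scl (\<epsilon> a) 1" for a
  proof -
    have "sw (d a) (\<lambda>x y. \<psi> x * act y) = sw (d a) (\<lambda>x y. sw (d x) (\<lambda>u v. scl (\<alpha> (S u)) (S v * act y)))"
      by (simp add: \<psi>_def sw_mult_right scl_mult_left)
    also have "\<dots> = sw (d a) (\<lambda>x y. sw (d y) (\<lambda>u v. scl (\<alpha> (S x)) (S u * act v)))"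
      by (rule coassocD) (intro lin_intro)
    also have "\<dots> = scl (\<epsilon> a) 1"
      by (simp only: sw_scl[symmetric] S_act \<alpha>_S)
    finally show ?thesis .
  qed
  have "\<psi> a = sw (d a) (\<lambda>x y. \<psi> x * act (scl (\<epsilon> y) 1))"
    using counit_right_lin[OF lin_\<psi>, of a] lin_act
    by (simp add: lin_def act_one scl_mult_right)
  also have "\<dots> = sw (d a) (\<lambda>x y. sw (d y) (\<lambda>u v. \<psi> x * act u * act (S v)))"
    unfolding S_right[symmetric] lin_sw[OF lin_act] act_mult sw_mult_left mult.assoc ..
  also have "\<dots> = sw (d a) (\<lambda>x y. sw (d x) (\<lambda>u v. \<psi> u * act v * act (S y)))"
    by (rule coassocD[symmetric]) (intro lin_intro)
  also have "\<dots> = sw (d a) (\<lambda>x y. sw (d x) (\<lambda>u v. \<psi> u * act v) * act (S y))"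
    by (simp only: sw_mult_right)
  also have "\<dots> = sw (d a) (\<lambda>x y. scl (\<epsilon> x) (act (S y)))"
    by (simp only: inv scl_mult_left mult_1_left)
  also have "\<dots> = act (S a)"
    by (rule counit_left_lin) (intro lin_intro)
  finally show ?thesis by (simp add: \<psi>_def)
qed

end

section \<open>Sweedler powers of an integral\<close>

context bialgebra_sums
begin

lemma sweedler_scl: "sweedler d m (scl c a) = scl c (sweedler d m a)"
  using lin_sweedler[of m] by (simp add: lin_def)

text \<open>
  \<open>sweedler_shift\<close> at \<open>a = \<Lambda>\<close>: on the left \<open>\<Lambda> b\<^sub>2 = \<alpha>(b\<^sub>2) \<Lambda>\<close>, on the right \<open>b\<^sub>1 \<Lambda> = \<epsilon>(b\<^sub>1) \<Lambda>\<close>.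
\<close>

lemma sweedler_integral_commute:
  assumes "left_integral scl \<epsilon> \<Lambda>" "\<And>a. \<Lambda> * a = scl (\<alpha> a) \<Lambda>"
  shows "sw (d b) (\<lambda>x y. scl (\<alpha> y) x) * sweedler d m \<Lambda> = sweedler d m \<Lambda> * b"
proof -
  have "sw (d b) (\<lambda>x y. scl (\<alpha> y) x) * sweedler d m \<Lambda> = sw (d b) (\<lambda>x y. x * sweedler d m (\<Lambda> * y))"
    by (simp add: sw_mult_right assms(2) sweedler_scl scl_mult_left scl_mult_right)
  also have "\<dots> = sw (d b) (\<lambda>x y. sweedler d m (x * \<Lambda>) * y)"
    by (rule sweedler_shift)
  also have "\<dots> = sweedler d m \<Lambda> * sw (d b) (\<lambda>x y. scl (\<epsilon> x) y)"
    using assms(1) by (simp add: left_integral_def sw_mult_left sweedler_scl scl_mult_left scl_mult_right)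
  finally show ?thesis by (simp add: counit_left)
qed

end

lemma (in twist_sums) sweedler_twist_integral:
  assumes "left_integral scl \<epsilon> \<Lambda>" "\<And>a. \<Lambda> * a = scl (\<alpha> a) \<Lambda>"
  shows "sw K (\<lambda>x y. scl (\<alpha> y) x) * sweedler d m \<Lambda> = sweedler d_twisted m \<Lambda>"
proof -
  have d_twisted_scl: "sweedler d_twisted m (scl c a) = scl c (sweedler d_twisted m a)" for c a
    using twisted.lin_sweedler[of m] by (simp add: lin_def)
  have "sw K (\<lambda>x y. scl (\<alpha> y) x) * sweedler d m \<Lambda> = sw K (\<lambda>x y. x * sweedler d m (\<Lambda> * y))"
    by (simp add: sw_mult_right assms(2) sweedler_scl scl_mult_left scl_mult_right)
  also have "\<dots> = sw K (\<lambda>x y. sweedler d_twisted m (x * \<Lambda>) * y)"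
    by (rule sweedler_twist)
  also have "\<dots> = sweedler d_twisted m \<Lambda> * sw K (\<lambda>x y. scl (\<epsilon> x) y)"
    using assms(1) by (simp add: left_integral_def sw_mult_left d_twisted_scl scl_mult_left scl_mult_right)
  finally show ?thesis by (simp add: K_left)
qed

section \<open>The element \<open>Q\<close> of a twist and its image under a character\<close>

locale hopf_twist = twist_sums scl d \<epsilon> J K + hopf_sums scl d \<epsilon> S
  for scl :: "'k::field \<Rightarrow> 'a::ring_1 \<Rightarrow> 'a" and d \<epsilon> J K S
begin

definition Q :: 'a where "Q = sw J (\<lambda>x y. S x * y)"

definition Q_inv :: 'a where "Q_inv = sw K (\<lambda>x y. x * S y)"

lemma K_right: "sw K (\<lambda>x y. scl (\<epsilon> y) x) = 1"
  using twist_sums.K_left[OF twist_sums_flip] by (simp add: sw_flip)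

text \<open>
  The middle factor \<open>J\<^sup>2 K\<^sup>1\<close> of \<open>Q K\<^sup>1 S(K\<^sup>2)\<close> belongs to \<open>(J \<otimes> 1)(1 \<otimes> K)\<close>, which equals
  \<open>(\<Delta> \<otimes> id)(K) (id \<otimes> \<Delta>)(J)\<close>; there the antipode cancels the comultiplied legs.
\<close>

lemma Q_Q_inv: "Q * Q_inv = 1"
proof -
  let ?g = "\<lambda>x y z. S x * y * S z"
  have "Q * Q_inv = sw3 (prod3 (leg12 J) (leg23 K)) ?g"
    by (simp add: Q_def Q_inv_def sw_mult sw_expand mult.assoc)
  also have "\<dots> = sw3 (prod3 (comult_left d K) (comult_right d J)) ?g"
    by (rule eq3D[OF mixed_left_right, symmetric]) (intro lin_intro)
  also have "\<dots> = sw K (\<lambda>k l. sw (d k) (\<lambda>u v. sw J (\<lambda>i j. sw (d j) (\<lambda>p q.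
      S i * (S u * v) * (p * S q) * S l))))"
    by (simp add: sw_expand S_mult mult.assoc)
  also have "\<dots> = sw K (\<lambda>k l. sw (d k) (\<lambda>u v. sw J (\<lambda>i j. S i * (S u * v) * scl (\<epsilon> j) (S l))))"
    by (intro sw_cong, simp only: sw_mult_right[symmetric] sw_mult_left[symmetric] S_right)
      (simp add: scl_mult_left scl_mult_right)
  also have "\<dots> = sw K (\<lambda>k l. sw J (\<lambda>i j. sw (d k) (\<lambda>u v. S i * (S u * v) * scl (\<epsilon> j) (S l))))"
    by (intro sw_cong sw_swap)
  also have "\<dots> = sw K (\<lambda>k l. sw J (\<lambda>i j. S i * (scl (\<epsilon> k) 1) * scl (\<epsilon> j) (S l)))"
    by (intro sw_cong) (simp only: sw_mult_right[symmetric] sw_mult_left[symmetric] S_left)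
  also have "\<dots> = sw K (\<lambda>k l. sw J (\<lambda>i j. S (scl (\<epsilon> j) i) * S (scl (\<epsilon> k) l)))"
    by (simp add: S_scl scl_mult_left scl_mult_right mult.commute)
  also have "\<dots> = S (sw J (\<lambda>i j. scl (\<epsilon> j) i)) * S (sw K (\<lambda>k l. scl (\<epsilon> k) l))"
    by (subst sw_swap) (simp only: sw_mult S_sw)
  finally show ?thesis by (simp add: J_right K_left S_one)
qed

text \<open>
  The same argument with \<open>(1 \<otimes> J)(K \<otimes> 1) = (id \<otimes> \<Delta>)(K) (\<Delta> \<otimes> id)(J)\<close>.
\<close>

lemma Q_inv_Q: "Q_inv * Q = 1"
proof -
  let ?g = "\<lambda>x y z. x * S y * z"
  have "Q_inv * Q = sw3 (prod3 (leg23 J) (leg12 K)) ?g"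
    unfolding Q_def Q_inv_def sw_mult sw_expand by (subst sw_swap) (simp add: S_mult mult.assoc)
  also have "\<dots> = sw3 (prod3 (comult_right d K) (comult_left d J)) ?g"
    by (rule eq3D[OF mixed_right_left, symmetric]) (intro lin_intro)
  also have "\<dots> = sw K (\<lambda>k l. sw (d l) (\<lambda>u v. sw J (\<lambda>i j. sw (d i) (\<lambda>p q.
      k * (p * S q) * (S u * v * j)))))"
    by (simp add: sw_expand S_mult mult.assoc)
  also have "\<dots> = sw K (\<lambda>k l. sw (d l) (\<lambda>u v. sw J (\<lambda>i j. k * (S u * v) * scl (\<epsilon> i) j)))"
    by (intro sw_cong, simp only: sw_mult_right[symmetric] sw_mult_left[symmetric] S_right)
      (simp add: scl_mult_left scl_mult_right mult.assoc)
  also have "\<dots> = sw K (\<lambda>k l. sw J (\<lambda>i j. sw (d l) (\<lambda>u v. k * (S u * v) * scl (\<epsilon> i) j)))"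
    by (intro sw_cong sw_swap)
  also have "\<dots> = sw K (\<lambda>k l. sw J (\<lambda>i j. k * (scl (\<epsilon> l) 1) * scl (\<epsilon> i) j))"
    by (intro sw_cong) (simp only: sw_mult_right[symmetric] sw_mult_left[symmetric] S_left)
  also have "\<dots> = sw K (\<lambda>k l. scl (\<epsilon> l) k) * sw J (\<lambda>i j. scl (\<epsilon> i) j)"
    by (simp add: sw_mult scl_mult_left scl_mult_right mult.commute)
  finally show ?thesis by (simp add: J_left K_right)
qed

end

locale hopf_twist_character = hopf_twist scl d \<epsilon> J K S + hopf_character scl d \<epsilon> S \<alpha>
  for scl :: "'k::field \<Rightarrow> 'a::ring_1 \<Rightarrow> 'a" and d \<epsilon> J K S \<alpha>
begin

definition T :: 'a where "T = sw K (\<lambda>x y. scl (\<alpha> y) x)"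

definition R :: 'a where "R = sw K (\<lambda>x y. scl (\<alpha> x) y)"

text \<open>
  The analogue of \<open>R\<close> for the character \<open>\<alpha> \<circ> S\<close>, the convolution inverse of \<open>\<alpha>\<close>.  The
  factor \<open>S R'\<close> of \<open>act Q\<close> is inverse to \<open>act (S R)\<close> up to the scalar \<open>\<alpha>(Q)\<close>, so it cancels in
  \<open>act (S R * Q)\<close>.
\<close>

definition R' :: 'a where "R' = sw K (\<lambda>x y. scl (\<alpha> (S x)) y)"

lemma lin_\<alpha>_S [lin_intro]: "lin g \<Longrightarrow> lin (\<lambda>x. scl (\<alpha> (S (g x))) c)"
  using lin_functional[OF \<alpha>D(1) lin_S_comp] .

lemma S_J_act: "sw J (\<lambda>x y. S x * act y) = Q * T"
proof -
  let ?g = "\<lambda>x y z. scl (\<alpha> z) (S x * y)"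
  have "sw J (\<lambda>x y. S x * act y) = sw3 (comult_right d J) ?g"
    by (simp add: act_def sw_expand sw_mult_left scl_mult_right)
  also have "\<dots> = sw3 (prod3 (comult_left d J) (prod3 (leg12 J) (leg23 K))) ?g"
    by (rule eq3D[OF comult_right_J]) (intro lin_intro)
  also have "\<dots> = sw J (\<lambda>i j. sw (d i) (\<lambda>p q. sw J (\<lambda>x y. sw K (\<lambda>k l.
      scl (\<alpha> j) (S x * (S p * q) * (scl (\<alpha> l) (y * k)))))))"
    by (simp add: sw_expand S_mult S_one \<alpha>D mult.assoc scl_mult_right)
  also have "\<dots> = sw J (\<lambda>i j. sw J (\<lambda>x y. sw K (\<lambda>k l.
      scl (\<alpha> j) (S x * sw (d i) (\<lambda>p q. S p * q) * (scl (\<alpha> l) (y * k))))))"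
    by (simp only: sw_scl sw_mult_left sw_mult_right sw_swap[of "d i" for i])
  also have "\<dots> = sw J (\<lambda>i j. scl (\<alpha> (scl (\<epsilon> i) j)) (Q * T))"
    by (simp add: S_left scl_mult_left scl_mult_right \<alpha>D functionalD Q_def T_def sw_mult sw_scl
        mult_ac)
  also have "\<dots> = scl (\<alpha> (sw J (\<lambda>i j. scl (\<epsilon> i) j))) (Q * T)"
    by (simp only: functionalD(4)[OF \<alpha>D(1)] sw_scl_left)
  finally show ?thesis by (simp add: J_left \<alpha>D)
qed

lemma act_Q: "act Q = scl (\<alpha> Q) (S R' * (Q * T))"
proof -
  let ?g = "\<lambda>x y z. scl (\<alpha> (S x)) (S y * act z)"
  have "act Q = sw J (\<lambda>x y. act (S x) * act y)"
    by (simp add: Q_def lin_sw[OF lin_act] act_mult)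
  also have "\<dots> = sw3 (comult_left d J) ?g"
    by (simp add: act_S sw_expand sw_mult_right scl_mult_left)
  also have "\<dots> = sw3 (prod3 (comult_right d J) (prod3 (leg23 J) (leg12 K))) ?g"
    by (rule eq3D[OF comult_left_J]) (intro lin_intro)
  also have "\<dots> = sw J (\<lambda>i j. sw (d j) (\<lambda>p q. sw J (\<lambda>x y. sw K (\<lambda>k l.
      scl (\<alpha> (S i)) (scl (\<alpha> (S k)) (S l) * (S x * (S p * act q) * act y))))))"
    by (simp add: sw_expand S_mult S_one act_one \<alpha>D act_mult mult.assoc scl_mult_left mult.commute)
  also have "\<dots> = sw J (\<lambda>i j. sw J (\<lambda>x y. sw K (\<lambda>k l.
      scl (\<alpha> (S i)) (scl (\<alpha> (S k)) (S l) * (S x * sw (d j) (\<lambda>p q. S p * act q) * act y)))))"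
    by (simp only: sw_scl sw_mult_left sw_mult_right sw_swap[of "d j" for j])
  also have "\<dots> = sw J (\<lambda>i j. sw J (\<lambda>x y. sw K (\<lambda>k l.
      scl (\<alpha> (S i * j)) (S (scl (\<alpha> (S k)) l) * (S x * act y)))))"
    by (simp add: S_act scl_mult_left scl_mult_right \<alpha>D S_scl mult_ac)
  also have "\<dots> = sw J (\<lambda>i j. scl (\<alpha> (S i * j)) (S R' * sw J (\<lambda>x y. S x * act y)))"
    by (subst sw_swap[of J K]) (simp only: R'_def S_sw sw_mult sw_scl)
  finally show ?thesis
    by (simp only: S_J_act) (simp only: Q_def functionalD(4)[OF \<alpha>D(1)] sw_scl_left)
qed

lemma act_S_R: "act (S R) * S R' = scl (\<alpha> Q_inv) 1"
proof -
  let ?g = "\<lambda>x y z. scl (\<alpha> x) (scl (\<alpha> (S y)) z)"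
  have "act (S R) = sw K (\<lambda>k l. sw (d l) (\<lambda>u v. scl (\<alpha> k) (scl (\<alpha> (S u)) (S v))))"
  proof -
    have "act (S R) = sw K (\<lambda>k l. scl (\<alpha> k) (act (S l)))"
      using lin_act by (simp add: R_def S_sw S_scl lin_sw lin_def)
    then show ?thesis by (simp only: act_S sw_scl)
  qed
  then have "act (S R) * S R' = sw K (\<lambda>k l. sw (d l) (\<lambda>u v. sw K (\<lambda>x y.
      S (scl (\<alpha> k) (scl (\<alpha> (S u)) (scl (\<alpha> (S x)) (y * v)))))))"
    by (simp only: R'_def S_sw sw_mult sw_mult_right)
      (simp add: sw_mult_left S_scl S_mult scl_mult_left scl_mult_right mult_ac)
  also have "\<dots> = S (sw3 (prod3 (leg23 K) (comult_right d K)) ?g)"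
    unfolding sw_expand S_sw
    by (subst sw_swap, intro sw_cong, subst sw_swap) (simp add: \<alpha>D S_mult mult_ac)
  also have "sw3 (prod3 (leg23 K) (comult_right d K)) ?g = sw3 (prod3 (leg12 K) (comult_left d K)) ?g"
    by (rule eq3D[OF twist_inverse]) (intro lin_intro)
  also have "\<dots> = sw K (\<lambda>x y. sw K (\<lambda>k l. sw (d k) (\<lambda>u v.
      scl (\<alpha> (x * S y)) (scl (\<alpha> u) (scl (\<alpha> (S v)) l)))))"
    by (simp add: sw_expand \<alpha>D S_mult mult_ac)
  also have "\<dots> = sw K (\<lambda>x y. scl (\<alpha> (x * S y)) (sw K (\<lambda>k l. scl (\<epsilon> k) l)))"
    by (simp only: sw_scl[symmetric] \<alpha>_S(2))
  also have "\<dots> = scl (\<alpha> Q_inv) 1"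
    by (simp only: K_left Q_inv_def functionalD(4)[OF \<alpha>D(1)] sw_scl_left)
  finally show ?thesis by (simp add: S_scl S_one)
qed

lemma act_S_R_Q: "act (S R * Q) = Q * T"
proof -
  have "act (S R * Q) = scl (\<alpha> Q) (act (S R) * S R' * (Q * T))"
    by (simp add: act_mult act_Q scl_mult_right mult.assoc)
  also have "\<dots> = scl (\<alpha> (Q * Q_inv)) (Q * T)"
    by (simp only: act_S_R) (simp add: scl_mult_left \<alpha>D)
  finally show ?thesis by (simp add: Q_Q_inv \<alpha>D)
qed

text \<open>
  The commutation rule for the co-opposite bialgebra reads \<open>\<alpha>(b\<^sub>1) b\<^sub>2 N = N b\<close>.  For \<open>a = S(c)\<close> it is used
  with \<open>b = \<alpha>(S(c\<^sub>1)) c\<^sub>2\<close>: then the factor on the left is \<open>c\<close>, while \<open>S(b) = act (S c) = act a\<close>.  The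
  antipode turns the equation around.
\<close>

lemma S_sweedler_flip_commute:
  assumes int: "left_integral scl \<epsilon> \<Lambda>" "\<And>a. \<Lambda> * a = scl (\<alpha> a) \<Lambda>" and S: "surj S"
  shows "S (sweedler (\<lambda>a. flip (d a)) m \<Lambda>) * a = act a * S (sweedler (\<lambda>a. flip (d a)) m \<Lambda>)"
proof -
  interpret F: twist_sums scl "\<lambda>a. flip (d a)" \<epsilon> "flip J" "flip K"
    by (rule twist_sums_flip)
  let ?N = "sweedler (\<lambda>a. flip (d a)) m \<Lambda>"
  obtain c where c: "a = S c" using S by (metis surjD)
  define b where "b = sw (d c) (\<lambda>x y. scl (\<alpha> (S x)) y)"
  define h where "h z = sw (d z) (\<lambda>u v. scl (\<alpha> u) v)" for z
  have "lin h"
    unfolding h_def by (intro lin_intro)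
  then have "h b = sw (d c) (\<lambda>x y. scl (\<alpha> (S x)) (h y))"
    by (simp add: b_def lin_sw lin_def)
  also have "\<dots> = sw (d c) (\<lambda>x y. scl (\<alpha> (S x)) (sw (d y) (\<lambda>u v. scl (\<alpha> u) v)))"
    by (simp only: h_def)
  also have "\<dots> = sw (d c) (\<lambda>x y. sw (d x) (\<lambda>u v. scl (\<alpha> (S u)) (scl (\<alpha> v) y)))"
    unfolding sw_scl by (rule coassocD[symmetric]) (intro lin_intro)
  also have "\<dots> = c"
    by (simp only: \<alpha>_S(1) counit_left)
  finally have "c * ?N = ?N * b"
    using F.sweedler_integral_commute[of \<Lambda> \<alpha> b m] int by (simp add: sw_flip h_def)
  then have "S ?N * S c = S b * S ?N"
    by (simp add: S_mult[symmetric])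
  moreover have "S b = act (S c)"
    by (simp add: b_def act_S S_sw S_scl)
  ultimately show ?thesis by (simp add: c)
qed

end

section \<open>Integrals of finite-dimensional Hopf algebras\<close>

locale hopf_integral = hopf_sums scl d \<epsilon> S
  for scl :: "'k::field \<Rightarrow> 'a::ring_1 \<Rightarrow> 'a" and d \<epsilon> S +
  fixes \<Lambda> :: 'a and B :: "'a set"
  assumes integral: "left_integral scl \<epsilon> \<Lambda>" and nonzero: "\<Lambda> \<noteq> 0"
    and finite_dim: "finite_dimensional_vector_space scl B"
begin

sublocale fd: finite_dimensional_vector_space scl B
  by (rule finite_dim)

definition coord :: "'a \<Rightarrow> 'a \<Rightarrow> 'k" where
  "coord b x = representation B x b"

lemma functional_coord: "functional (coord b)"
  unfolding coord_def
  by (intro functionalI)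
    (simp_all add: representation_add representation_scale fd.independent_Basis fd.span_Basis)

lemma coord_sum: "(\<Sum>b\<in>B. scl (coord b x) b) = x"
  unfolding coord_def
  using sum_representation_eq[of B x B] by (simp add: fd.independent_Basis fd.span_Basis fd.finite_Basis)

lemma coord_basis: "b \<in> B \<Longrightarrow> coord c b = (if c = b then 1 else 0)"
  unfolding coord_def by (simp add: representation_basis fd.independent_Basis)

text \<open>
  The action of a functional \<open>f\<close> on \<open>\<Lambda>\<close> in the Hopf module structure that the algebra carries over its
  dual.
\<close>

definition \<Phi> :: "('a \<Rightarrow> 'k) \<Rightarrow> 'a" where
  "\<Phi> f = sw (d \<Lambda>) (\<lambda>x y. scl (f (S y)) x)"

lemma integral_mult: "h * \<Lambda> = scl (\<epsilon> h) \<Lambda>"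
  using integral by (simp add: left_integral_def)

text \<open>
  In tensor form this is \<open>h \<Lambda>\<^sub>1 \<otimes> S(\<Lambda>\<^sub>2) = h\<^sub>1 \<Lambda>\<^sub>1 \<otimes> S(\<Lambda>\<^sub>2) S(h\<^sub>2) h\<^sub>3 = \<Lambda>\<^sub>1 \<otimes> S(\<Lambda>\<^sub>2) h\<close>: since \<open>h\<^sub>1 \<Lambda>\<close> is a
  multiple of \<open>\<Lambda>\<close>, the first two legs of \<open>h\<close> disappear.
\<close>

lemma \<Phi>_mult_left:
  assumes "functional f"
  shows "h * \<Phi> f = \<Phi> (\<lambda>x. f (x * h))"
proof -
  note [lin_intro] = lin_functional[OF assms]
  have "h * \<Phi> f = sw (d \<Lambda>) (\<lambda>x y. sw (d h) (\<lambda>u v. scl (\<epsilon> v) (scl (f (S y)) (u * x))))"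
    by (simp only: \<Phi>_def sw_mult_left scl_mult_right, intro sw_cong, subst counit_right_lin)
      (intro lin_intro, simp)
  also have "\<dots> = sw (d \<Lambda>) (\<lambda>x y. sw (d h) (\<lambda>u v. sw (d v) (\<lambda>p q. scl (f (S y * (S p * q))) (u * x))))"
    by (simp only: sw_scl_left[symmetric] functionalD(4)[OF assms, symmetric] sw_mult_left[symmetric] S_left)
      (simp add: scl_mult_right functionalD[OF assms])
  also have "\<dots> = sw (d \<Lambda>) (\<lambda>x y. sw (d h) (\<lambda>u v. sw (d u) (\<lambda>p q. scl (f (S y * (S q * v))) (p * x))))"
    by (intro sw_cong coassocD[symmetric] lin_intro)
  also have "\<dots> = sw (d h) (\<lambda>u v. sw (d u) (\<lambda>p q. sw (d \<Lambda>) (\<lambda>x y. scl (f (S (q * y) * v)) (p * x))))"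
    by (subst sw_swap, intro sw_cong, subst sw_swap) (simp add: S_mult mult.assoc)
  also have "\<dots> = sw (d h) (\<lambda>u v. sw (d (u * \<Lambda>)) (\<lambda>x y. scl (f (S y * v)) x))"
    by (intro sw_cong, subst d_multD) (intro lin_intro, simp)
  also have "\<dots> = sw (d h) (\<lambda>u v. scl (\<epsilon> u) (sw (d \<Lambda>) (\<lambda>x y. scl (f (S y * v)) x)))"
  proof -
    have "lin (\<lambda>a. sw (d a) (\<lambda>x y. scl (f (S y * v)) x))" for v
      by (intro lin_intro)
    then show ?thesis by (simp add: integral_mult lin_def)
  qed
  also have "\<dots> = sw (d \<Lambda>) (\<lambda>x y. scl (f (S y * h)) x)"
    by (rule counit_left_lin) (intro lin_intro)
  finally show ?thesis by (simp add: \<Phi>_def)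
qed

lemma sw_sum: "sw t (\<lambda>x y. \<Sum>b\<in>X. F b x y) = (\<Sum>b\<in>X. sw t (F b))"
  by (induction t) (auto simp: sum.distrib)

text \<open>
  The antipode gives \<open>f(1) \<Lambda> = \<Lambda>\<^sub>1 f(S(S(\<Lambda>\<^sub>2) \<Lambda>\<^sub>3)) = \<Lambda>\<^sub>1 f(S(\<Lambda>\<^sub>3) S(S(\<Lambda>\<^sub>2)))\<close>.  Expanding \<open>S(S(\<Lambda>\<^sub>2))\<close> in the
  basis presents the right-hand side as a sum over \<open>b\<close> of bilinear expressions in the comultiplication
  of \<open>\<Phi> (\<lambda>x. f (x * b)) = 0\<close>.
\<close>

lemma \<Phi>_vanishes_at_one:
  assumes f: "functional f" and z: "\<And>h. \<Phi> (\<lambda>x. f (x * h)) = 0"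
  shows "f 1 = 0"
proof -
  note [lin_intro] = lin_functional[OF f] lin_functional[OF functional_coord]
  define F where "F b u v = scl (coord b (S (S v))) u" for b u v
  have F: "bilin (F b)" for b
    unfolding F_def by (intro lin_intro)
  have "scl (f 1) \<Lambda> = sw (d \<Lambda>) (\<lambda>u w. scl (\<epsilon> w) (scl (f 1) u))"
    by (subst counit_right_lin) (intro lin_intro, simp)
  also have "\<dots> = sw (d \<Lambda>) (\<lambda>u w. sw (d w) (\<lambda>v y. scl (f (S (S v * y))) u))"
    by (simp only: sw_scl_left[symmetric] functionalD(4)[OF f, symmetric] S_sw[symmetric] S_left)
      (simp add: S_scl S_one functionalD[OF f])
  also have "\<dots> = sw (d \<Lambda>) (\<lambda>x y. sw (d x) (\<lambda>u v. scl (f (S y * S (S v))) u))"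
    unfolding S_mult by (rule coassocD[symmetric]) (intro lin_intro)
  also have "\<dots> = sw (d \<Lambda>) (\<lambda>x y. sw (d x) (\<lambda>u v. \<Sum>b\<in>B. scl (f (S y * b)) (F b u v)))"
  proof (intro sw_cong)
    fix x y u v
    have "f (S y * S (S v)) = f (S y * (\<Sum>b\<in>B. scl (coord b (S (S v))) b))"
      by (simp add: coord_sum)
    also have "\<dots> = (\<Sum>b\<in>B. f (S y * b) * coord b (S (S v)))"
    proof -
      interpret Vector_Spaces.linear scl "(*)" f by fact
      show ?thesis by (simp add: sum_distrib_left scl_mult_right sum scale mult.commute)
    qed
    finally show "scl (f (S y * S (S v))) u = (\<Sum>b\<in>B. scl (f (S y * b)) (F b u v))"
      by (simp add: F_def scale_sum_left)
  qed
  also have "\<dots> = (\<Sum>b\<in>B. sw (d (\<Phi> (\<lambda>x. f (x * b)))) (F b))"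
  proof -
    have "lin (\<lambda>x. sw (d x) (F b))" for b by (rule d_lin[OF F])
    then show ?thesis
      by (simp add: sw_sum \<Phi>_def sw_scl[symmetric])
        (simp add: lin_sw[where f = "\<lambda>x. sw (d x) (F b)" for b] lin_def)
  qed
  also have "\<dots> = 0"
    using lin_zero[OF d_lin[OF F]] by (simp add: z)
  finally show ?thesis using nonzero by simp
qed

lemma \<Phi>_eq_0_imp:
  assumes f: "functional f" and "\<Phi> f = 0"
  shows "f h = 0"
proof -
  have fh: "functional (\<lambda>x. f (x * h))" for h
    by (rule functional_lin[OF f]) (intro lin_intro)
  have z: "\<Phi> (\<lambda>x. f (x * h)) = 0" for h
    using \<Phi>_mult_left[OF f, of h] assms(2) by simp
  have "(\<lambda>x. f (x * h)) 1 = 0"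
    by (rule \<Phi>_vanishes_at_one[OF fh]) (use z[of "k * h" for k] in \<open>simp add: mult.assoc\<close>)
  then show ?thesis by simp
qed

text \<open>
  A functional that vanishes on the range of \<open>S\<close> is in the kernel of \<open>\<Phi>\<close>.
\<close>

lemma surj_S: "surj S"
proof (rule ccontr)
  assume "\<not> surj S"
  then obtain x where x: "x \<notin> range S" by auto
  have "subspace (range S)"
  proof (unfold subspace_def, safe)
    show "0 \<in> range S" using lin_zero[OF lin_S] by (metis rangeI)
    show "S x + S y \<in> range S" for x y
      using lin_S by (intro range_eqI[of _ _ "x + y"]) (simp add: lin_def)
    show "scl c (S x) \<in> range S" for c x
      by (intro range_eqI[of _ _ "scl c x"]) (simp add: S_scl)
  qed
  then have "x \<notin> span (range S)" using x by (metis span_eq_iff)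
  from functional_separating_span[OF this] obtain f
    where f: "functional f" "\<forall>u\<in>range S. f u = 0" "f x = 1" by blast
  then have "\<Phi> f = 0" by (simp add: \<Phi>_def)
  from \<Phi>_eq_0_imp[OF f(1) this] f(3) show False by simp
qed

text \<open>
  \<open>\<Phi>\<close> is injective, and the dual space has the same dimension as the algebra.  The bilinear form \<open>F\<close>
  with orthonormal basis \<open>B\<close> identifies the two spaces, which turns \<open>\<Phi>\<close> into an endomorphism.
\<close>

lemma \<Phi>_surj: "\<exists>f. functional f \<and> \<Phi> f = a"
proof -
  define F where "F x y = (\<Sum>b\<in>B. coord b x * coord b y)" for x y
  have F: "functional (F x)" for x
    unfolding F_def by (intro functionalI)
      (simp_all add: functionalD[OF functional_coord] sum.distrib sum_distrib_left algebra_simps)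
  have F_add: "F (x + y) z = F x z + F y z" and F_scl: "F (scl c x) z = c * F x z" for c x y z
    by (simp_all add: F_def functionalD[OF functional_coord] sum.distrib sum_distrib_left algebra_simps)
  have lin: "lin (\<lambda>x. \<Phi> (F x))"
    by (simp add: lin_def \<Phi>_def F_add F_scl scale_left_distrib sw_add sw_scl)
  then have lin': "Vector_Spaces.linear scl scl (\<lambda>x. \<Phi> (F x))"
    by (intro Vector_Spaces.linear_iff[THEN iffD2] conjI allI vector_space_axioms) (auto simp: lin_def)
  interpret L: Vector_Spaces.linear scl scl "\<lambda>x. \<Phi> (F x)" by (rule lin')
  interpret pair: finite_dimensional_vector_space_pair scl B scl B ..
  have "inj (\<lambda>x. \<Phi> (F x))"
    unfolding L.inj_iff_eq_0
  proof (intro allI impI)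
    fix x assume "\<Phi> (F x) = 0"
    from \<Phi>_eq_0_imp[OF F this] have "F x b = 0" for b by simp
    moreover have "F x b = coord b x" if "b \<in> B" for b
      using that by (simp add: F_def coord_basis fd.finite_Basis if_distrib cong: if_cong)
    ultimately have "coord b x = 0" if "b \<in> B" for b using that by simp
    then show "x = 0" using coord_sum[of x] by simp
  qed
  then have "surj (\<lambda>x. \<Phi> (F x))" by (rule pair.linear_injective_imp_surjective[OF lin' _ refl])
  from surjD[OF this, of a] obtain x where "a = \<Phi> (F x)" by blast
  then show ?thesis using F[of x] by blast
qed

text \<open>
  Write \<open>\<Lambda>' = \<Phi> f\<close>.  Then \<open>h \<Lambda>' = \<epsilon>(h) \<Lambda>'\<close> and injectivity of \<open>\<Phi>\<close> force \<open>f(h) = \<epsilon>(h) f(1)\<close>, and for such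
  an \<open>f\<close> the counit collapses \<open>\<Phi> f\<close> to \<open>f(1) \<Lambda>\<close>.
\<close>

lemma integral_unique:
  assumes "left_integral scl \<epsilon> \<Lambda>'"
  shows "\<exists>c. \<Lambda>' = scl c \<Lambda>"
proof -
  obtain f where f: "functional f" "\<Phi> f = \<Lambda>'" using \<Phi>_surj by blast
  have fh: "functional (\<lambda>x. f (x * h))" for h
    by (rule functional_lin[OF f(1)]) (intro lin_intro)
  have "f (1 * h) - \<epsilon> h * f 1 = 0" for h
  proof (rule \<Phi>_eq_0_imp[where f = "\<lambda>x. f (x * h) - \<epsilon> h * f x"])
    show "functional (\<lambda>x. f (x * h) - \<epsilon> h * f x)"
      by (intro functionalI) (simp_all add: functionalD[OF f(1)] functionalD[OF fh] algebra_simps)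
    have "\<Phi> (\<lambda>x. f (x * h) - \<epsilon> h * f x) + scl (\<epsilon> h) (\<Phi> f) = \<Phi> (\<lambda>x. f (x * h))"
      by (simp add: \<Phi>_def sw_scl sw_add[symmetric] scale_left_diff_distrib)
    also have "\<dots> = h * \<Lambda>'"
      using \<Phi>_mult_left[OF f(1)] f(2) by simp
    also have "\<dots> = scl (\<epsilon> h) (\<Phi> f)"
      using assms f(2) by (simp add: left_integral_def)
    finally show "\<Phi> (\<lambda>x. f (x * h) - \<epsilon> h * f x) = 0" by simp
  qed
  from this[of "S y" for y] have "f (S y) = \<epsilon> y * f 1" for y by (simp add: counit_S)
  then have "\<Lambda>' = sw (d \<Lambda>) (\<lambda>x y. scl (\<epsilon> y) (scl (f 1) x))"
    using f(2) by (simp add: \<Phi>_def)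
  also have "\<dots> = scl (f 1) \<Lambda>"
    by (rule counit_right_lin) (intro lin_intro)
  finally show ?thesis by blast
qed

text \<open>
  \<open>\<Lambda> a\<close> is again a left integral, hence a multiple of \<open>\<Lambda>\<close>.
\<close>

lemma distinguished_grouplike_exists:
  "\<exists>!\<alpha>. algebra_character scl \<alpha> \<and> (\<forall>a. \<Lambda> * a = scl (\<alpha> a) \<Lambda>)"
proof -
  have cancel: "scl c \<Lambda> = scl e \<Lambda> \<longleftrightarrow> c = e" for c e
    using nonzero by simp
  have "left_integral scl \<epsilon> (\<Lambda> * a)" for a
    using integral by (simp add: left_integral_def mult.assoc[symmetric] scl_mult_left)
  then have "\<forall>a. \<exists>c. \<Lambda> * a = scl c \<Lambda>" using integral_unique by blast
  then obtain \<alpha> where \<alpha>: "\<And>a. \<Lambda> * a = scl (\<alpha> a) \<Lambda>" by metis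
  have "\<alpha> (a + b) = \<alpha> a + \<alpha> b" "\<alpha> (scl c a) = c * \<alpha> a" "\<alpha> 1 = 1" "\<alpha> (a * b) = \<alpha> a * \<alpha> b" for a b c
  proof -
    have "scl (\<alpha> (a + b)) \<Lambda> = scl (\<alpha> a + \<alpha> b) \<Lambda>"
      by (simp add: \<alpha>[symmetric] scale_left_distrib distrib_left)
    moreover have "scl (\<alpha> (scl c a)) \<Lambda> = scl (c * \<alpha> a) \<Lambda>"
      by (simp add: \<alpha>[symmetric] scl_mult_right flip: scale_scale)
    moreover have "scl (\<alpha> 1) \<Lambda> = scl 1 \<Lambda>"
      by (simp add: \<alpha>[symmetric])
    moreover have "scl (\<alpha> (a * b)) \<Lambda> = scl (\<alpha> a * \<alpha> b) \<Lambda>"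
    proof -
      have "scl (\<alpha> (a * b)) \<Lambda> = (\<Lambda> * a) * b" by (simp add: \<alpha>[symmetric] mult.assoc)
      also have "\<dots> = scl (\<alpha> a * \<alpha> b) \<Lambda>" by (simp add: \<alpha> scl_mult_left)
      finally show ?thesis .
    qed
    ultimately show "\<alpha> (a + b) = \<alpha> a + \<alpha> b" "\<alpha> (scl c a) = c * \<alpha> a" "\<alpha> 1 = 1"
      "\<alpha> (a * b) = \<alpha> a * \<alpha> b"
      by (simp_all only: cancel)
  qed
  then have "algebra_character scl \<alpha>"
    by (simp add: algebra_character_def functionalI)
  then show ?thesis using \<alpha> cancel by (intro ex1I[of _ \<alpha>]) (auto simp: fun_eq_iff)
qed

end

section \<open>From tensors to Sweedler sums\<close>

context k_algebra
begin

lemma multilin_of_bilin: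
  assumes f: "bilin f"
  shows "multilin 2 (\<lambda>w. f (w ! 0) (w ! 1))"
  unfolding multilin_def
proof (intro allI impI)
  fix u v :: "'a list" assume len: "length u + 1 + length v = 2"
  then consider "length u = 0" "length v = 1" | "length u = 1" "length v = 0" by linarith
  then show "lin (\<lambda>x. f ((u @ x # v) ! 0) ((u @ x # v) ! 1))"
    by cases (auto simp: length_Suc_conv bilinD[OF f])
qed

lemma multilin_of_trilin:
  assumes f: "trilin f"
  shows "multilin 3 (\<lambda>w. f (w ! 0) (w ! 1) (w ! 2))"
  unfolding multilin_def
proof (intro allI impI)
  fix u v :: "'a list" assume len: "length u + 1 + length v = 3"
  then consider "length u = 0" "length v = Suc 1" | "length u = 1" "length v = 1"
    | "length u = Suc 1" "length v = 0" by linarith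
  then show "lin (\<lambda>x. f ((u @ x # v) ! 0) ((u @ x # v) ! 1) ((u @ x # v) ! 2))"
    by cases (auto simp: length_Suc_conv numeral_2_eq_2 trilinD[OF f])
qed

lemma bilin_of_multilin:
  assumes "multilin (Suc (Suc (length w))) f"
  shows "bilin (\<lambda>x y. f (x # y # w))"
proof (intro bilinI)
  show "lin (\<lambda>x. f (x # y # w))" for y
    using assms[unfolded multilin_def, rule_format, of "[]" "y # w"] by simp
  show "lin (\<lambda>y. f (x # y # w))" for x
    using assms[unfolded multilin_def, rule_format, of "[x]" w] by simp
qed

definition represents2 :: "('a, 'k) tensor \<Rightarrow> ('a \<times> 'a) list \<Rightarrow> bool" where
  "represents2 t L \<longleftrightarrow> t \<in> tensor_power scl 2 \<and> (\<forall>f. bilin f \<longrightarrow> sweedler_sum scl f t = sw L f)"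

definition represents3 :: "('a, 'k) tensor \<Rightarrow> ('a \<times> 'a \<times> 'a) list \<Rightarrow> bool" where
  "represents3 t L \<longleftrightarrow> t \<in> tensor_power scl 3 \<and>
     (\<forall>g. trilin g \<longrightarrow> ev t (\<lambda>w. g (w ! 0) (w ! 1) (w ! 2)) = sw3 L g)"

text \<open>
  The coefficients of a formal combination of words are absorbed into the first factors.
\<close>

lemma represents2_exists:
  assumes "t \<in> tensor_power scl 2"
  shows "\<exists>L. represents2 t L"
proof -
  obtain ws where ws: "set ws = Poly_Mapping.keys (tensor_rep t)" "distinct ws"
    using finite_distinct_list[OF finite_keys[of "tensor_rep t"]] by blast
  define L where "L = map (\<lambda>w. (scl (Poly_Mapping.lookup (tensor_rep t) w) (w ! 0), w ! 1)) ws"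
  have "sweedler_sum scl f t = sw L f" if "bilin f" for f
  proof -
    have "sweedler_sum scl f t = (\<Sum>w\<leftarrow>ws. scl (Poly_Mapping.lookup (tensor_rep t) w) (f (w ! 0) (w ! 1)))"
      using ws by (simp add: sweedler_sum_def tensor_eval_def lin_ext_def sum_list_distinct_conv_sum_set)
    also have "\<dots> = sw L f"
      using bilinD(1)[OF that] by (simp add: L_def sw_def o_def lin_def)
    finally show ?thesis .
  qed
  then show ?thesis using assms unfolding represents2_def by blast
qed

lemma represents2D:
  assumes "represents2 t L"
  shows "t \<in> tensor_power scl 2"
    and "bilin f \<Longrightarrow> sweedler_sum scl f t = sw L f"
    and "bilin f \<Longrightarrow> ev t (\<lambda>w. f (w ! 0) (w ! 1)) = sw L f"
  using assms by (simp_all add: represents2_def sweedler_sum_def)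

lemma represents3D:
  assumes "represents3 t L"
  shows "t \<in> tensor_power scl 3"
    and "trilin g \<Longrightarrow> ev t (\<lambda>w. g (w ! 0) (w ! 1) (w ! 2)) = sw3 L g"
  using assms by (simp_all add: represents3_def)

lemma represents2_eq2:
  "represents2 t L \<Longrightarrow> represents2 t L' \<Longrightarrow> eq2 L L'"
  by (auto simp: represents2_def eq2_def)

lemma represents3_eq3:
  "represents3 t L \<Longrightarrow> represents3 t L' \<Longrightarrow> eq3 L L'"
  by (auto simp: represents3_def eq3_def)

lemma ev_represents2:
  assumes "represents2 t L" "multilin 2 f"
  shows "ev t f = sw L (\<lambda>x y. f [x, y])"
proof -
  note [simp del] = One_nat_def
  have t: "t \<in> tensor_power scl 2" using assms(1) by (simp add: represents2_def)
  have "bilin (\<lambda>x y. f [x, y])"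
    using bilin_of_multilin[of "[]"] assms(2) by (simp add: numeral_2_eq_2)
  then have "sw L (\<lambda>x y. f [x, y]) = ev t (\<lambda>w. f [w ! 0, w ! 1])"
    by (rule represents2D(3)[OF assms(1), symmetric])
  also have "\<dots> = ev t f"
    by (rule ev_cong[OF t]) (auto simp: One_nat_def numeral_2_eq_2 length_Suc_conv)
  finally show ?thesis ..
qed

lemma represents2_one: "represents2 (tensor_one scl 2) [(1, 1)]"
  unfolding represents2_def tensor_one_def sweedler_sum_def
  using ev_pure[of "replicate 2 1"] multilin_of_bilin
  by (simp add: pure_tensor_closed numeral_2_eq_2 del: One_nat_def)

lemma represents2_mult:
  assumes s: "represents2 s L" and t: "represents2 t L'"
  shows "represents2 (tensor_mult scl 2 s t) (prod2 L L')"
proof -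
  note [simp del] = One_nat_def
  have st: "s \<in> tensor_power scl 2" "t \<in> tensor_power scl 2"
    using s t by (simp_all add: represents2_def)
  have "sweedler_sum scl f (tensor_mult scl 2 s t) = sw (prod2 L L') f" if f: "bilin f" for f
  proof -
    note [lin_intro] = bilinD[OF f, THEN lin_comp]
    have "sweedler_sum scl f (tensor_mult scl 2 s t) =
        ev s (\<lambda>u. ev t (\<lambda>v. f (map2 (*) u v ! 0) (map2 (*) u v ! 1)))"
      by (simp add: sweedler_sum_def ev_mult[OF st] multilin_of_bilin[OF f])
    also have "\<dots> = ev s (\<lambda>u. ev t (\<lambda>v. f (u ! 0 * v ! 0) (u ! 1 * v ! 1)))"
      by (intro ev_cong[OF st(1)] ev_cong[OF st(2)]) simp
    also have "\<dots> = ev s (\<lambda>u. sw L' (\<lambda>x y. f (u ! 0 * x) (u ! 1 * y)))"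
      by (intro arg_cong[of _ _ "ev s"] ext represents2D(3)[OF t] lin_intro)
    also have "\<dots> = sw L (\<lambda>p q. sw L' (\<lambda>x y. f (p * x) (q * y)))"
      by (intro represents2D(3)[OF s] lin_intro)
    finally show ?thesis by (simp add: sw_prod2)
  qed
  then show ?thesis using tensor_mult_closed[OF st] by (simp add: represents2_def)
qed

lemma represents3_mult:
  assumes s: "represents3 s L" and t: "represents3 t L'"
  shows "represents3 (tensor_mult scl 3 s t) (prod3 L L')"
proof -
  note [simp del] = One_nat_def
  have st: "s \<in> tensor_power scl 3" "t \<in> tensor_power scl 3"
    using s t by (simp_all add: represents3_def)
  have "ev (tensor_mult scl 3 s t) (\<lambda>w. f (w ! 0) (w ! 1) (w ! 2)) = sw3 (prod3 L L') f"
    if f: "trilin f" for f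
  proof -
    note [lin_intro] = trilinD[OF f, THEN lin_comp]
    have "ev (tensor_mult scl 3 s t) (\<lambda>w. f (w ! 0) (w ! 1) (w ! 2)) =
        ev s (\<lambda>u. ev t (\<lambda>v. f (map2 (*) u v ! 0) (map2 (*) u v ! 1) (map2 (*) u v ! 2)))"
      by (simp add: ev_mult[OF st] multilin_of_trilin[OF f])
    also have "\<dots> = ev s (\<lambda>u. ev t (\<lambda>v. f (u ! 0 * v ! 0) (u ! 1 * v ! 1) (u ! 2 * v ! 2)))"
      by (intro ev_cong[OF st(1)] ev_cong[OF st(2)]) simp
    also have "\<dots> = ev s (\<lambda>u. sw3 L' (\<lambda>x y z. f (u ! 0 * x) (u ! 1 * y) (u ! 2 * z)))"
      by (intro arg_cong[of _ _ "ev s"] ext represents3D(2)[OF t] lin_intro)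
    also have "\<dots> = sw3 L (\<lambda>p q r. sw3 L' (\<lambda>x y z. f (p * x) (q * y) (r * z)))"
      by (intro represents3D(2)[OF s] lin_intro)
    finally show ?thesis by (simp add: sw3_prod3)
  qed
  then show ?thesis using tensor_mult_closed[OF st] by (simp add: represents3_def)
qed

lemma represents3_leg:
  assumes t: "represents2 t L"
  shows "represents3 (tensor_prod scl 2 1 t (tensor_one scl 1)) (leg12 L)"
    and "represents3 (tensor_prod scl 1 2 (tensor_one scl 1) t) (leg23 L)"
proof -
  note [simp del] = One_nat_def
  have t': "t \<in> tensor_power scl 2" using t by (simp add: represents2_def)
  have o: "tensor_one scl 1 \<in> tensor_power scl 1"
    by (simp add: tensor_one_def pure_tensor_closed)
  have one: "ev (tensor_one scl 1) h = h [1]" if "lin (\<lambda>x. h [x])" for h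
  proof -
    have "multilin 1 h" using that by (simp add: multilin_def)
    then show ?thesis by (simp add: tensor_one_def ev_pure One_nat_def)
  qed
  have "ev (tensor_prod scl 2 1 t (tensor_one scl 1)) (\<lambda>w. g (w ! 0) (w ! 1) (w ! 2)) = sw3 (leg12 L) g"
    and "ev (tensor_prod scl 1 2 (tensor_one scl 1) t) (\<lambda>w. g (w ! 0) (w ! 1) (w ! 2)) = sw3 (leg23 L) g"
    if g: "trilin g" for g
  proof -
    have "ev (tensor_prod scl 2 1 t (tensor_one scl 1)) (\<lambda>w. g (w ! 0) (w ! 1) (w ! 2)) =
        ev t (\<lambda>u. ev (tensor_one scl 1) (\<lambda>v. g ((u @ v) ! 0) ((u @ v) ! 1) ((u @ v) ! 2)))"
      using multilin_of_trilin[OF g] by (simp add: ev_prod[OF t' o])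
    also have "\<dots> = ev t (\<lambda>u. g (u ! 0) (u ! 1) 1)"
      by (intro ev_cong[OF t'], subst one) (simp_all add: nth_append trilinD[OF g])
    also have "\<dots> = sw3 (leg12 L) g"
      unfolding sw_expand by (intro represents2D(3)[OF t] bilinI trilinD[OF g])
    finally show "ev (tensor_prod scl 2 1 t (tensor_one scl 1)) (\<lambda>w. g (w ! 0) (w ! 1) (w ! 2)) =
        sw3 (leg12 L) g" .
    have b: "bilin (\<lambda>x y. g a x y)" for a by (intro bilinI trilinD[OF g])
    have l: "lin (\<lambda>a. sw L (\<lambda>x y. g a x y))" by (intro lin_intro trilinD[OF g])
    have "ev (tensor_prod scl 1 2 (tensor_one scl 1) t) (\<lambda>w. g (w ! 0) (w ! 1) (w ! 2)) =
        ev (tensor_one scl 1) (\<lambda>u. ev t (\<lambda>v. g ((u @ v) ! 0) ((u @ v) ! 1) ((u @ v) ! 2)))"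
      using multilin_of_trilin[OF g] by (simp add: ev_prod[OF o t'])
    also have "\<dots> = ev (tensor_one scl 1) (\<lambda>u. ev t (\<lambda>v. g (u ! 0) (v ! 0) (v ! 1)))"
      by (intro ev_cong[OF o] ev_cong[OF t']) (simp add: nth_append One_nat_def)
    also have "\<dots> = ev (tensor_one scl 1) (\<lambda>u. sw L (\<lambda>x y. g (u ! 0) x y))"
      by (intro arg_cong[of _ _ "ev _"] ext represents2D(3)[OF t] b)
    also have "\<dots> = sw3 (leg23 L) g"
      by (subst one) (simp_all add: l sw_expand)
    finally show "ev (tensor_prod scl 1 2 (tensor_one scl 1) t) (\<lambda>w. g (w ! 0) (w ! 1) (w ! 2)) =
        sw3 (leg23 L) g" .
  qed
  then show "represents3 (tensor_prod scl 2 1 t (tensor_one scl 1)) (leg12 L)"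
    and "represents3 (tensor_prod scl 1 2 (tensor_one scl 1) t) (leg23 L)"
    using tensor_prod_closed[OF t' o] tensor_prod_closed[OF o t'] by (simp_all add: represents3_def)
qed

lemma represents3_comult:
  assumes t: "represents2 t L" and D: "\<And>a. represents2 (D a) (d a)"
    and d_lin: "\<And>f. bilin f \<Longrightarrow> lin (\<lambda>a. sw (d a) f)"
  shows "represents3 (comult_at scl 2 0 D t) (comult_left d L)"
    and "represents3 (comult_at scl 2 1 D t) (comult_right d L)"
proof -
  note [simp del] = One_nat_def
  have t': "t \<in> tensor_power scl 2" and D': "D a \<in> tensor_power scl 2" for a
    using t D by (simp_all add: represents2_def)
  have "ev (comult_at scl 2 0 D t) (\<lambda>w. g (w ! 0) (w ! 1) (w ! 2)) = sw3 (comult_left d L) g"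
    and "ev (comult_at scl 2 1 D t) (\<lambda>w. g (w ! 0) (w ! 1) (w ! 2)) = sw3 (comult_right d L) g"
    if g: "trilin g" for g
  proof -
    have b: "bilin (\<lambda>u v. g u v y)" "bilin (\<lambda>u v. g y u v)" for y
      by (intro bilinI trilinD[OF g])+
    have g': "multilin (2 + 1) (\<lambda>w. g (w ! 0) (w ! 1) (w ! 2))"
      using multilin_of_trilin[OF g] by simp
    have "ev (comult_at scl 2 0 D t) (\<lambda>w. g (w ! 0) (w ! 1) (w ! 2)) =
        ev t (\<lambda>w. ev (D (w ! 0)) (\<lambda>v. g (v ! 0) (v ! 1) (w ! 1)))"
      by (subst ev_comult_at[OF t' _ D' g'], simp, intro ev_cong[OF t'] ev_cong[OF D'])
        (simp add: nth_append)
    also have "\<dots> = ev t (\<lambda>w. sw (d (w ! 0)) (\<lambda>u v. g u v (w ! 1)))"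
      by (intro arg_cong[of _ _ "ev t"] ext represents2D(3)[OF D] b)
    also have "\<dots> = sw3 (comult_left d L) g"
      unfolding sw_expand
      by (intro represents2D(3)[OF t] bilinI d_lin b lin_sw_arg trilinD[OF g])
    finally show "ev (comult_at scl 2 0 D t) (\<lambda>w. g (w ! 0) (w ! 1) (w ! 2)) = sw3 (comult_left d L) g" .
    have "ev (comult_at scl 2 1 D t) (\<lambda>w. g (w ! 0) (w ! 1) (w ! 2)) =
        ev t (\<lambda>w. ev (D (w ! 1)) (\<lambda>v. g (w ! 0) (v ! 0) (v ! 1)))"
      by (subst ev_comult_at[OF t' _ D' g'], simp, intro ev_cong[OF t'] ev_cong[OF D'])
        (simp add: nth_append One_nat_def)
    also have "\<dots> = ev t (\<lambda>w. sw (d (w ! 1)) (\<lambda>u v. g (w ! 0) u v))"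
      by (intro arg_cong[of _ _ "ev t"] ext represents2D(3)[OF D] b)
    also have "\<dots> = sw3 (comult_right d L) g"
      unfolding sw_expand
      by (intro represents2D(3)[OF t] bilinI d_lin b lin_sw_arg trilinD[OF g])
    finally show "ev (comult_at scl 2 1 D t) (\<lambda>w. g (w ! 0) (w ! 1) (w ! 2)) = sw3 (comult_right d L) g" .
  qed
  then show "represents3 (comult_at scl 2 0 D t) (comult_left d L)"
    and "represents3 (comult_at scl 2 1 D t) (comult_right d L)"
    using comult_at_closed[OF t' _ D', of 0] comult_at_closed[OF t' _ D', of 1]
    by (simp_all add: represents3_def)
qed

text \<open>
  Representatives of the two inverses are equivalent by the usual argument in a monoid, and evaluations
  separate tensors.
\<close>

lemma tensor_inverse_unique:
  assumes "is_tensor_inverse scl 2 t s" "is_tensor_inverse scl 2 t s'" "t \<in> tensor_power scl 2"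
    and one: "(1::'a) \<noteq> 0"
  shows "s = s'"
proof -
  have s: "s \<in> tensor_power scl 2" and s': "s' \<in> tensor_power scl 2"
    using assms by (simp_all add: is_tensor_inverse_def)
  obtain L L' M where L: "represents2 s L" and L': "represents2 s' L'" and M: "represents2 t M"
    using represents2_exists s s' assms(3) by metis
  have left: "eq2 (prod2 L M) [(1, 1)]" and right: "eq2 (prod2 M L') [(1, 1)]"
    using represents2_mult[OF L M] represents2_mult[OF M L'] assms(1,2) represents2_one
    by (auto simp: is_tensor_inverse_def intro: represents2_eq2)
  have "eq2 (prod2 L [(1, 1)]) (prod2 L (prod2 M L'))"
    by (intro prod2_cong eq2_refl eq2_sym[OF right])
  also have "\<dots> = prod2 (prod2 L M) L'" by (simp only: prod2_assoc)
  also have "eq2 \<dots> (prod2 [(1, 1)] L')"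
    by (intro prod2_cong eq2_refl left)
  finally have "eq2 L L'" by simp
  then have "ev s f = ev s' f" if "multilin 2 f" for f
    unfolding ev_represents2[OF L that] ev_represents2[OF L' that]
    using bilin_of_multilin[of "[]" f] that by (simp add: eq2_def numeral_2_eq_2)
  then show ?thesis by (intro tensor_eqI[OF s s' _ one])
qed

end

text \<open>
  The words of the iterated comultiplication, expanded in the first leg as in \<open>iterated_comult\<close>.
\<close>

primrec comult_words :: "('a \<Rightarrow> ('a \<times> 'a) list) \<Rightarrow> nat \<Rightarrow> 'a \<Rightarrow> 'a list list" where
  "comult_words d 0 a = [[a]]"
| "comult_words d (Suc m) a =
     concat (map (\<lambda>w. map (\<lambda>(x, y). x # y # tl w) (d (hd w))) (comult_words d m a))"

lemma comult_words_nonempty: "w \<in> set (comult_words d m a) \<Longrightarrow> w \<noteq> []"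
  by (induction m arbitrary: w) auto

lemma concat_map_concat: "concat (map f (concat xss)) = concat (map (\<lambda>xs. concat (map f xs)) xss)"
  by (induction xss) auto

text \<open>
  Expanding the first leg of every word amounts to comultiplying once and iterating in the first leg.
  In this form the last letter is split off, which matches the recursion of \<open>sweedler\<close>.
\<close>

lemma comult_words_Suc:
  "comult_words d (Suc m) a = concat (map (\<lambda>(x, y). map (\<lambda>w. w @ [y]) (comult_words d m x)) (d a))"
proof (induction m)
  case (Suc m)
  have "map (\<lambda>(p, q). p # q # tl (w @ [y])) (d (hd (w @ [y]))) =
      map (\<lambda>w. w @ [y]) (map (\<lambda>(p, q). p # q # tl w) (d (hd w)))"
    if "w \<in> set (comult_words d m x)" for w x y
    using comult_words_nonempty[OF that] by (simp add: split_def o_def)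
  then have "concat (map (\<lambda>w. map (\<lambda>(p, q). p # q # tl w) (d (hd w))) (map (\<lambda>w. w @ [y]) (comult_words d m x))) =
      map (\<lambda>w. w @ [y]) (comult_words d (Suc m) x)" for x y
    by (simp add: map_concat o_def cong: map_cong)
  then show ?case
    by (subst comult_words.simps(2), subst Suc)
      (simp add: concat_map_concat o_def split_def del: comult_words.simps)
next
  case 0
  have "map (\<lambda>(x, y). [x, y]) t = concat (map (\<lambda>(x, y). [[x, y]]) t)" for t :: "('a \<times> 'a) list"
    by (induction t) auto
  then show ?case by (simp add: split_def)
qed

lemma sum_list_concat_map:
  "(\<Sum>w\<leftarrow>concat (map F xs). f w) = (\<Sum>x\<leftarrow>xs. \<Sum>w\<leftarrow>F x. (f w :: 'b::comm_monoid_add))"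
  by (induction xs) auto

lemma comult_words_prod:
  "(\<Sum>w\<leftarrow>comult_words d m a. prod_list w) = sweedler d m a"
proof (induction m arbitrary: a)
  case (Suc m)
  have "(\<Sum>w\<leftarrow>comult_words d (Suc m) a. prod_list w) =
      (\<Sum>(x, y)\<leftarrow>d a. (\<Sum>w\<leftarrow>comult_words d m x. prod_list w) * y)"
    unfolding comult_words_Suc sum_list_concat_map
    by (simp add: split_def o_def sum_list_mult_const)
  then show ?case by (simp add: Suc sw_def)
qed simp

context k_algebra
begin

lemma ev_iterated_comult:
  assumes D: "\<And>a. represents2 (D a) (d a)" and d_lin: "\<And>f. bilin f \<Longrightarrow> lin (\<lambda>a. sw (d a) f)"
  shows "iterated_comult scl D m a \<in> tensor_power scl (Suc m)"
    and "multilin (Suc m) f \<Longrightarrow> ev (iterated_comult scl D m a) f = (\<Sum>w\<leftarrow>comult_words d m a. f w)"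
proof -
  have D': "D a \<in> tensor_power scl 2" for a
    using D by (simp add: represents2_def)
  show cl: "iterated_comult scl D m a \<in> tensor_power scl (Suc m)" for m
    using comult_at_closed[OF _ _ D'] by (induction m) (auto simp: pure_tensor_closed)
  show "ev (iterated_comult scl D m a) f = (\<Sum>w\<leftarrow>comult_words d m a. f w)" if "multilin (Suc m) f"
    using that
  proof (induction m arbitrary: f)
    case 0
    then show ?case by (simp add: ev_pure)
  next
    case (Suc m)
    define F where "F w = sw (d (hd w)) (\<lambda>x y. f (x # y # tl w))" for w
    have f: "multilin (Suc m + 1) f" using Suc.prems by simp
    have b: "bilin (\<lambda>x y. f (x # y # w))" if "length w = m" for w
      using bilin_of_multilin[of w f] Suc.prems that by simp
    have F: "multilin (Suc m) F"
      unfolding multilin_def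
    proof (intro allI impI)
      fix u v :: "'a list" assume len: "length u + 1 + length v = Suc m"
      show "lin (\<lambda>x. F (u @ x # v))"
      proof (cases u)
        case Nil
        then show ?thesis using len by (simp add: F_def d_lin b)
      next
        case (Cons h u')
        have "lin (\<lambda>x. f (p # q # u' @ x # v))" for p q
          using Suc.prems[unfolded multilin_def, rule_format, of "p # q # u'" v] len Cons by simp
        then show ?thesis using Cons by (simp add: F_def lin_sw_arg)
      qed
    qed
    have "ev (iterated_comult scl D (Suc m) a) f =
        ev (iterated_comult scl D m a) (\<lambda>w. ev (D (w ! 0)) (\<lambda>v. f (take 0 w @ v @ drop (0 + 1) w)))"
      by (simp only: iterated_comult.simps) (rule ev_comult_at[OF cl _ D' f], simp)
    also have "\<dots> = ev (iterated_comult scl D m a) F"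
    proof (rule ev_cong[OF cl])
      fix w :: "'a list" assume len: "length w = Suc m"
      then obtain h r where w: "w = h # r" "length r = m" by (auto simp: length_Suc_conv)
      note [simp del] = One_nat_def
      have "ev (D h) (\<lambda>v. f (v @ r)) = ev (D h) (\<lambda>v. f (v ! 0 # v ! 1 # r))"
        by (rule ev_cong[OF D']) (auto simp: One_nat_def numeral_2_eq_2 length_Suc_conv)
      also have "\<dots> = sw (d h) (\<lambda>x y. f (x # y # r))"
        by (rule represents2D(3)[OF D b[OF w(2)]])
      finally show "ev (D (w ! 0)) (\<lambda>v. f (take 0 w @ v @ drop (0 + 1) w)) = F w"
        by (simp add: w F_def One_nat_def)
    qed
    also have "\<dots> = (\<Sum>w\<leftarrow>comult_words d (Suc m) a. f w)"
      by (simp add: Suc.IH[OF F] sum_list_concat_map F_def sw_def o_def split_def)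
    finally show ?case .
  qed
qed

lemma multilin_prod_list: "multilin n prod_list" "multilin n (\<lambda>w. prod_list (rev w))"
  by (auto simp: multilin_def mult.assoc intro!: lin_intro)

lemma ev_iterated_comult_prod:
  assumes D: "\<And>a. represents2 (D a) (d a)" and d_lin: "\<And>f. bilin f \<Longrightarrow> lin (\<lambda>a. sw (d a) f)"
  shows "ev (iterated_comult scl D m a) prod_list = sweedler d m a"
  by (simp add: ev_iterated_comult[OF assms] multilin_prod_list comult_words_prod)

text \<open>
  Reversing the product puts the last letter in front, so the recursion is the one of
  \<open>sweedler_Suc_left\<close> in the co-opposite coalgebra; here coassociativity enters.
\<close>

lemma ev_iterated_comult_prod_rev:
  assumes D: "\<And>a. represents2 (D a) (d a)"
    and d: "coalgebra_sums scl d" and d': "coalgebra_sums scl (\<lambda>a. flip (d a))"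
  shows "ev (iterated_comult scl D m a) (\<lambda>w. prod_list (rev w)) = sweedler (\<lambda>a. flip (d a)) m a"
proof -
  interpret C: coalgebra_sums scl d by fact
  interpret C': coalgebra_sums scl "\<lambda>a. flip (d a)" by fact
  have "(\<Sum>w\<leftarrow>comult_words d m a. prod_list (rev w)) = sweedler (\<lambda>a. flip (d a)) m a"
  proof (induction m arbitrary: a)
    case (Suc m)
    have "(\<Sum>w\<leftarrow>comult_words d (Suc m) a. prod_list (rev w)) =
        (\<Sum>(x, y)\<leftarrow>d a. y * (\<Sum>w\<leftarrow>comult_words d m x. prod_list (rev w)))"
      unfolding comult_words_Suc sum_list_concat_map
      by (simp add: split_def o_def sum_list_const_mult)
    then show ?case unfolding C'.sweedler_Suc_left
      by (simp add: Suc sw_def o_def split_def del: comult_words.simps)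
  qed simp
  then show ?thesis
    by (simp add: ev_iterated_comult[OF D C.d_lin] multilin_prod_list)
qed

end

lemma (in hopf_algebra) hopf_sums_exist:
  "\<exists>d. hopf_sums scl d \<epsilon> S \<and> (\<forall>a. represents2 (\<Delta> a) (d a))"
proof -
  have "\<forall>a. \<exists>L. represents2 (\<Delta> a) L"
    using represents2_exists comult_closed by blast
  then obtain d where d: "\<And>a. represents2 (\<Delta> a) (d a)" by metis
  then have sw_d: "sweedler_sum scl f (\<Delta> a) = sw (d a) f" if "bilin f" for f a
    using that by (simp add: represents2_def)
  have d_lin: "lin (\<lambda>a. sw (d a) f)" if f: "bilin f" for f
    unfolding lin_def sw_d[OF f, symmetric] comult_add comult_scale sweedler_sum_def
    using multilin_of_bilin[OF f] comult_closed by (simp add: ev_add ev_scale)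
  have l\<epsilon>: "lin (\<lambda>x. scl (\<epsilon> x) c)" for c
    using lin_functional[OF characterD(1)[OF counit_character] lin_id] .
  have lS: "lin S"
    using antipode_linear by (simp add: Vector_Spaces.linear_iff lin_def)
  have "hopf_sums scl d \<epsilon> S"
  proof
    show "lin (\<lambda>a. sw (d a) f)" if "bilin f" for f by (rule d_lin[OF that])
    show "eq3 (comult_left d (d a)) (comult_right d (d a))" for a
      using represents3_comult[where D = \<Delta>, OF d d d_lin, of a] coassoc[of a]
      by (auto intro: represents3_eq3)
    show "eq2 (d (a * b)) (prod2 (d a) (d b))" for a b
      using represents2_mult[OF d d, of a b] d[of "a * b"] comult_mult by (auto intro: represents2_eq2)
    show "eq2 (d 1) [(1, 1)]"
      using d[of 1] represents2_one comult_one by (auto intro: represents2_eq2)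
    show "sw (d a) (\<lambda>x y. scl (\<epsilon> x) y) = a" for a
      by (subst sw_d[symmetric]) (intro lin_intro l\<epsilon>, rule counit_left)
    show "sw (d a) (\<lambda>x y. scl (\<epsilon> y) x) = a" for a
      by (subst sw_d[symmetric]) (intro lin_intro l\<epsilon>, rule counit_right)
    show "sw (d a) (\<lambda>x y. S x * y) = scl (\<epsilon> a) 1" for a
      by (subst sw_d[symmetric]) (intro lin_intro lS lin_comp[OF lS], rule antipode_left)
    show "sw (d a) (\<lambda>x y. x * S y) = scl (\<epsilon> a) 1" for a
      by (subst sw_d[symmetric]) (intro lin_intro lS lin_comp[OF lS], rule antipode_right)
  qed (use counit_character lS in simp_all)
  then show ?thesis using d by blast
qed

section \<open>Sweedler powers of integrals in twisted Hopf algebras\<close>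

theorem theorem3p4:
  fixes scl :: "'k::field \<Rightarrow> 'a::ring_1 \<Rightarrow> 'a"
    and \<Delta> :: "'a \<Rightarrow> ('a, 'k) tensor"
    and \<epsilon> :: "'a \<Rightarrow> 'k"
    and S :: "'a \<Rightarrow> 'a"
    and \<Lambda> :: 'a
    and J :: "('a, 'k) tensor"
    and \<alpha> :: "'a \<Rightarrow> 'k"
    and Q T R :: 'a
    and P PJ :: "int \<Rightarrow> 'a \<Rightarrow> 'a"
  assumes "hopf_algebra scl \<Delta> \<epsilon> S"
    and "\<exists>B. finite_dimensional_vector_space scl B"
    and "left_integral scl \<epsilon> \<Lambda>" and "\<Lambda> \<noteq> 0"
    and "normalized_twist scl \<Delta> \<epsilon> J"
    and "\<alpha> = distinguished_grouplike scl \<Lambda>"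
    and "Q = twist_Q scl S J"
    and "T = sweedler_sum scl (\<lambda>x y. scl (\<alpha> y) x) (tensor_inverse scl 2 J)"
    and "R = sweedler_sum scl (\<lambda>x y. scl (\<alpha> x) y) (tensor_inverse scl 2 J)"
    and "P = sweedler_power scl \<Delta> \<epsilon> S"
    and "PJ = sweedler_power scl (twisted_comult scl \<Delta> J) \<epsilon> (twisted_antipode scl S J)"
  shows "(\<forall>n. PJ n \<Lambda> = T * P n \<Lambda>) \<and>
         (\<forall>n. PJ n \<Lambda> = ring_inverse Q * P n \<Lambda> * S R * Q) \<and>
         (\<alpha> = \<epsilon> \<longrightarrow> (\<forall>n. PJ n \<Lambda> = P n \<Lambda>))"
proof -
  interpret hopf_algebra scl \<Delta> \<epsilon> S by fact
  obtain B where B: "finite_dimensional_vector_space scl B" using assms(2) by blast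
  obtain d where d: "hopf_sums scl d \<epsilon> S" "\<And>a. represents2 (\<Delta> a) (d a)"
    using hopf_sums_exist by blast
  interpret H: hopf_sums scl d \<epsilon> S by fact
  interpret I: hopf_integral scl d \<epsilon> S \<Lambda> B
    by (rule hopf_integral.intro[OF d(1) hopf_integral_axioms.intro[OF assms(3,4) B]])
  have one: "(1::'a) \<noteq> 0"
    using assms(4) by (metis mult_1_left mult_zero_left)

  have \<alpha>: "algebra_character scl \<alpha>" "\<And>a. \<Lambda> * a = scl (\<alpha> a) \<Lambda>"
    using theI'[OF I.distinguished_grouplike_exists] unfolding assms(6) distinguished_grouplike_def
    by blast+

  have twist: "J \<in> tensor_power scl 2"
    "sweedler_sum scl (\<lambda>x y. scl (\<epsilon> x) y) J = 1" "sweedler_sum scl (\<lambda>x y. scl (\<epsilon> y) x) J = 1"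
    "tensor_mult scl 3 (comult_at scl 2 0 \<Delta> J) (tensor_prod scl 2 1 J (tensor_one scl 1)) =
     tensor_mult scl 3 (comult_at scl 2 1 \<Delta> J) (tensor_prod scl 1 2 (tensor_one scl 1) J)"
    using assms(5) unfolding normalized_twist_def by blast+
  obtain K where K: "is_tensor_inverse scl 2 J K"
    using assms(5) unfolding normalized_twist_def by blast
  have K_eq: "tensor_inverse scl 2 J = K"
    unfolding tensor_inverse_def
    by (rule the_equality, rule K, rule tensor_inverse_unique[OF _ K twist(1) one])
  obtain js ks where js: "represents2 J js" and ks: "represents2 K ks"
    using represents2_exists twist(1) K by (metis is_tensor_inverse_def)
  note sw_js = js[unfolded represents2_def, THEN conjunct2, rule_format]
  note sw_ks = ks[unfolded represents2_def, THEN conjunct2, rule_format]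
  interpret W: hopf_twist scl d \<epsilon> js ks S
  proof
    show "eq2 (prod2 js ks) [(1, 1)]" "eq2 (prod2 ks js) [(1, 1)]"
      using represents2_mult[OF js ks] represents2_mult[OF ks js] K represents2_one
      by (auto simp: is_tensor_inverse_def intro: represents2_eq2)
    note c = represents3_comult[where D = \<Delta>, OF js d(2) H.d_lin]
    show "eq3 (prod3 (comult_left d js) (leg12 js)) (prod3 (comult_right d js) (leg23 js))"
      using represents3_mult[OF c(1) represents3_leg(1)[OF js]]
        represents3_mult[OF c(2) represents3_leg(2)[OF js]] twist(4)
      by (auto intro: represents3_eq3)
    show "sw js (\<lambda>x y. scl (\<epsilon> x) y) = 1"
      by (subst sw_js[symmetric]) (intro lin_intro, rule twist(2))
    show "sw js (\<lambda>x y. scl (\<epsilon> y) x) = 1"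
      by (subst sw_js[symmetric]) (intro lin_intro, rule twist(3))
  qed
  interpret C: hopf_twist_character scl d \<epsilon> js ks S \<alpha>
    using \<alpha>(1) by unfold_locales
  interpret F: twist_sums scl "\<lambda>a. flip (d a)" \<epsilon> "flip js" "flip ks"
    by (rule W.twist_sums_flip)

  have Q: "Q = W.Q"
    unfolding assms(7) twist_Q_def W.Q_def by (rule sw_js) (intro lin_intro)
  have Q_inv: "ring_inverse Q = W.Q_inv"
    unfolding ring_inverse_def Q
  proof (rule the_equality)
    fix y assume y: "W.Q * y = 1 \<and> y * W.Q = 1"
    have "y = (y * W.Q) * W.Q_inv" by (simp add: mult.assoc W.Q_Q_inv)
    then show "y = W.Q_inv" using y by simp
  qed (simp add: W.Q_Q_inv W.Q_inv_Q)
  have T: "T = C.T"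
    unfolding assms(8) K_eq C.T_def by (rule sw_ks) (intro lin_intro)
  have R: "R = C.R"
    unfolding assms(9) K_eq C.R_def by (rule sw_ks) (intro lin_intro)

  have d_twisted: "represents2 (twisted_comult scl \<Delta> J a) (W.d_twisted a)" for a
    unfolding twisted_comult_def K_eq W.d_twisted_def by (intro represents2_mult ks d(2) js)
  have flip_d_twisted: "F.d_twisted = (\<lambda>a. flip (W.d_twisted a))"
    by (rule ext) (rule W.d_twisted_flip)
  let ?N = "\<lambda>m. sweedler (\<lambda>a. flip (d a)) m \<Lambda>"
  have P_pos: "P n \<Lambda> = sweedler d (nat n - 1) \<Lambda>" if "n \<ge> 1" for n
    using that unfolding assms(10) sweedler_power_def
    by (simp add: ev_iterated_comult_prod[OF d(2) H.d_lin])
  have PJ_pos: "PJ n \<Lambda> = sweedler W.d_twisted (nat n - 1) \<Lambda>" if "n \<ge> 1" for n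
    using that unfolding assms(11) sweedler_power_def
    by (simp add: ev_iterated_comult_prod[OF d_twisted W.twisted.d_lin])
  have P_neg: "P n \<Lambda> = S (?N (nat (- n) - 1))" if "n < 0" for n
    using that unfolding assms(10) sweedler_power_def
    by (simp add: ev_iterated_comult_prod_rev[OF d(2) H.coalgebra_sums_axioms F.coalgebra_sums_axioms])
  have PJ_neg: "PJ n \<Lambda> = W.Q_inv * S (C.R * ?N (nat (- n) - 1)) * W.Q" if "n < 0" for n
  proof -
    have "ev (iterated_comult scl (twisted_comult scl \<Delta> J) m \<Lambda>) (\<lambda>w. prod_list (rev w)) = C.R * ?N m" for m
      using ev_iterated_comult_prod_rev[OF d_twisted W.twisted.coalgebra_sums_axioms, of m \<Lambda>]
        F.twisted.coalgebra_sums_axioms F.sweedler_twist_integral[OF assms(3) \<alpha>(2), of m]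
      by (simp add: flip_d_twisted sw_flip C.R_def)
    then show ?thesis
      using that unfolding assms(11) sweedler_power_def twisted_antipode_def
      by (simp add: Q_inv[unfolded Q assms(7)] Q[unfolded assms(7)] Q_inv[unfolded assms(7)])
  qed
  have P_zero: "P 0 \<Lambda> = scl (\<epsilon> \<Lambda>) 1" "PJ 0 \<Lambda> = scl (\<epsilon> \<Lambda>) 1"
    unfolding assms(10,11) sweedler_power_def by simp_all

  \<comment> \<open>Right multiplication of a Sweedler power of \<open>\<Lambda>\<close> becomes left multiplication by \<open>act\<close>; this links the two formulas.\<close>
  have commute: "P n \<Lambda> * a = C.act a * P n \<Lambda>" if "n \<noteq> 0" for n a
  proof (cases "n < 0")
    case True
    then show ?thesis
      using C.S_sweedler_flip_commute[OF assms(3) \<alpha>(2) I.surj_S] by (simp add: P_neg)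
  next
    case False
    then show ?thesis
      using that H.sweedler_integral_commute[OF assms(3) \<alpha>(2)] by (simp add: P_pos C.act_def)
  qed
  have conj: "W.Q_inv * P n \<Lambda> * S C.R * W.Q = C.T * P n \<Lambda>" if "n \<noteq> 0" for n
  proof -
    have "W.Q_inv * P n \<Lambda> * S C.R * W.Q = W.Q_inv * (P n \<Lambda> * (S C.R * W.Q))"
      by (simp add: mult.assoc)
    also have "\<dots> = (W.Q_inv * W.Q) * C.T * P n \<Lambda>"
      by (simp only: commute[OF that] C.act_S_R_Q mult.assoc)
    finally show ?thesis by (simp add: W.Q_inv_Q)
  qed
  have unimodular: "C.T = 1" "C.R = 1" if "\<alpha> = \<epsilon>"
    unfolding C.T_def C.R_def using W.K_left W.K_right that by simp_all
  \<comment> \<open>Apply \<open>\<epsilon>\<close> to \<open>\<Lambda> a = \<alpha>(a) \<Lambda>\<close>.\<close>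
  have zero: "\<epsilon> \<Lambda> = 0 \<or> \<alpha> = \<epsilon>"
  proof -
    have "\<epsilon> \<Lambda> * \<epsilon> a = \<epsilon> \<Lambda> * \<alpha> a" for a
    proof -
      have "\<epsilon> \<Lambda> * \<epsilon> a = \<epsilon> (\<Lambda> * a)" by (simp add: H.counitD)
      also have "\<dots> = \<epsilon> \<Lambda> * \<alpha> a" by (simp add: \<alpha>(2) functionalD[OF H.counitD(1)])
      finally show ?thesis .
    qed
    then show ?thesis by auto
  qed
  have main: "PJ n \<Lambda> = T * P n \<Lambda> \<and> PJ n \<Lambda> = ring_inverse Q * P n \<Lambda> * S R * Q" for n
  proof -
    consider "n \<ge> 1" | "n < 0" | "n = 0" by linarith
    then show ?thesis
    proof cases
      case 1
      then have "PJ n \<Lambda> = C.T * P n \<Lambda>"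
        using W.sweedler_twist_integral[OF assms(3) \<alpha>(2)] by (simp add: PJ_pos P_pos C.T_def)
      then show ?thesis using 1 conj[of n] by (simp add: T R Q_inv Q[symmetric])
    next
      case 2
      then have "PJ n \<Lambda> = W.Q_inv * P n \<Lambda> * S C.R * W.Q"
        by (simp add: PJ_neg P_neg H.S_mult mult.assoc)
      then show ?thesis using 2 conj[of n] by (simp add: T R Q_inv Q[symmetric])
    next
      case 3
      then show ?thesis
        using zero unimodular
        by (auto simp: P_zero T R Q_inv[unfolded Q] Q scl_mult_left scl_mult_right W.Q_inv_Q H.S_one)
    qed
  qed
  moreover have "PJ n \<Lambda> = P n \<Lambda>" if "\<alpha> = \<epsilon>" for n
    using main[of n] unimodular(1)[OF that] by (simp add: T)
  ultimately show ?thesis by blast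
qed

end
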